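(* Let $n\geq 3$, $m\ge 0$ integers and $\rho>0$. Let $$p(\theta)=\rho+\sum_{k=0}^{m}\big(a_{kn+1}\cos(kn+1)\theta+b_{kn+1}\sin(kn+1)\theta+a_{kn-1}\cos(kn-1)\theta+b_{kn-1}\sin(kn-1)\theta\big)$$ be a real trigonometric polynomial satisfying $p+p''\geq 0$ on $\mathbb{R}$, and let $\mathcal{C}$ be the curve parametrized by $\theta\in[-\pi,\pi]\mapsto\big(p(\theta)\cos\theta-p'(\theta)\sin\theta,\ p(\theta)\sin\theta+p'(\theta)\cos\theta\big)$ (an algebraic rotor of the regular $n$-gon with apothem $\rho$). Assume $\mathcal{C}$ is not a circle and $a_{nm+1}\neq 0$ or $b_{nm+1}\neq 0$. Then the defining polynomial $f\in\mathbb{R}[x,y]$ of $\mathcal{C}$ has total degree $2nm+4$, and $\deg_x(f)=\deg_y(f)=2nm+4$.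
   Context: The defining polynomial of the curve $\mathcal{C}$ is the irreducible polynomial $f\in\mathbb{R}[x,y]$, unique up to a nonzero constant factor, whose zero set is the Zariski closure of $\mathcal{C}$. $\deg_x,\deg_y$ denote partial degrees. *)

theory Defs
  imports "HOL-Analysis.Analysis" "HOL-Computational_Algebra.Polynomial"
begin

text \<open>Bivariate real polynomials f(x,y) are represented as polynomials in y
whose coefficients are polynomials in x: type real poly poly.\<close>

definition eval2 :: "real poly poly \<Rightarrow> real \<Rightarrow> real \<Rightarrow> real" where
  "eval2 f x y = poly (map_poly (\<lambda>c. poly c x) f) y"

definition deg_y :: "real poly poly \<Rightarrow> nat" where
  "deg_y f = degree f"

definition deg_x :: "real poly poly \<Rightarrow> nat" where
  "deg_x f = Max (insert 0 {degree (coeff f i) | i. i \<le> degree f})"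

definition total_degree :: "real poly poly \<Rightarrow> nat" where
  "total_degree f = Max (insert 0 {degree (coeff f i) + i | i. i \<le> degree f \<and> coeff f i \<noteq> 0})"

definition zariski_closure :: "(real \<times> real) set \<Rightarrow> (real \<times> real) set" where
  "zariski_closure S =
     {(x, y). \<forall>g. (\<forall>(u, v) \<in> S. eval2 g u v = 0) \<longrightarrow> eval2 g x y = 0}"

definition defining_poly :: "(real \<times> real) set \<Rightarrow> real poly poly \<Rightarrow> bool" where
  "defining_poly C f \<longleftrightarrow> irreducible f \<and> {(x, y). eval2 f x y = 0} = zariski_closure C"

definition is_circle :: "(real \<times> real) set \<Rightarrow> bool" where
  "is_circle C \<longleftrightarrow> (\<exists>c1 c2 r. r > 0 \<and> C = {(x, y). (x - c1)^2 + (y - c2)^2 = r^2})"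

end

theory Submission
  imports Defs "HOL-Computational_Algebra.Polynomial_Factorial"
    "HOL-Computational_Algebra.Field_as_Ring"
    "HOL-Computational_Algebra.Fundamental_Theorem_Algebra"
begin

text \<open>
  With \<open>t = cis \<theta>\<close> and \<open>D = n m + 1\<close>, the coordinates x and y of the curve become Laurent
  polynomials in t with poles of order \<open>D + 1\<close> at 0 and at infinity, so x takes every value at
  \<open>N = 2 D + 2\<close> points t. The polynomials vanishing on the curve form a prime ideal, generated by
  an irreducible f whose y-degree is at most N by a count of monomials.

  For generic \<open>x\<^sub>0\<close> the values of y at the N points over \<open>x\<^sub>0\<close> are distinct: if s and t have the
  same image, the gradient of f there is normal to both branches, hence their tangents agree. The
  tangent at t has normal direction t, which forces \<open>s\<^sup>2 = t\<^sup>2\<close>, and \<open>s = - t\<close> is impossible for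
  generic t because \<open>x + \<i> y\<close> contains the odd term \<open>\<rho> t\<close>. So f has y-degree N, and over generic
  \<open>x\<^sub>0\<close> it splits with roots the values of y. As x and y have the same order of growth
  at 0 and at infinity, the coefficient of \<open>y ^ j\<close> has degree at most \<open>N - j\<close>, with equality
  for \<open>j = 0\<close>. The coefficient of \<open>y ^ N\<close> is constant because f is primitive.
\<close>

subsection \<open>Complex evaluation of real polynomials\<close>

definition cpoly :: "real poly \<Rightarrow> complex poly" where
  "cpoly a = map_poly complex_of_real a"

text \<open>Only x receives a value; y stays an indeterminate, so that f over a fixed
  \<open>x0\<close> can be factored into linear factors.\<close>

definition specialize :: "real poly poly \<Rightarrow> complex \<Rightarrow> complex poly" where
  "specialize f x = map_poly (\<lambda>a. poly (cpoly a) x) f"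

definition ceval :: "real poly poly \<Rightarrow> complex \<Rightarrow> complex \<Rightarrow> complex" where
  "ceval f x y = poly (specialize f x) y"

lemma cpoly_0 [simp]: "cpoly 0 = 0"
  and cpoly_pCons [simp]: "cpoly (pCons r a) = pCons (of_real r) (cpoly a)"
  by (simp_all add: cpoly_def map_poly_pCons)

lemma coeff_cpoly [simp]: "coeff (cpoly a) i = of_real (coeff a i)"
  by (simp add: cpoly_def coeff_map_poly)

lemma degree_cpoly [simp]: "degree (cpoly a) = degree a"
  by (simp add: cpoly_def degree_map_poly)

lemma cpoly_eq_0_iff [simp]: "cpoly a = 0 \<longleftrightarrow> a = 0"
  by (simp add: poly_eq_iff)

lemma cpoly_add: "cpoly (a + b) = cpoly a + cpoly b"
  by (simp add: poly_eq_iff)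

lemma cpoly_mult: "cpoly (a * b) = cpoly a * cpoly b"
  by (simp add: poly_eq_iff coeff_mult)

lemma cpoly_pderiv: "cpoly (pderiv a) = pderiv (cpoly a)"
  by (simp add: poly_eq_iff coeff_pderiv)

lemma poly_cpoly_of_real: "poly (cpoly a) (of_real x) = of_real (poly a x)"
  by (induction a) simp_all

lemma coeff_specialize [simp]: "coeff (specialize f x) i = poly (cpoly (coeff f i)) x"
  by (simp add: specialize_def coeff_map_poly)

lemma degree_specialize_le: "degree (specialize f x) \<le> degree f"
  by (rule degree_le) (simp add: coeff_eq_0)

lemma degree_specialize:
  assumes "poly (cpoly (lead_coeff f)) x \<noteq> 0"
  shows "degree (specialize f x) = degree f"
  using assms degree_specialize_le[of f x] by (auto intro!: antisym le_degree)

lemma ceval_0 [simp]: "ceval 0 x y = 0"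
  and ceval_pCons [simp]: "ceval (pCons a f) x y = poly (cpoly a) x + y * ceval f x y"
  by (simp_all add: ceval_def specialize_def map_poly_pCons)

lemma ceval_add: "ceval (f + g) x y = ceval f x y + ceval g x y"
proof -
  have "specialize (f + g) x = specialize f x + specialize g x"
    by (simp add: poly_eq_iff cpoly_add)
  then show ?thesis by (simp add: ceval_def)
qed

lemma ceval_smult: "ceval (smult a f) x y = poly (cpoly a) x * ceval f x y"
  by (induction f) (simp_all add: cpoly_mult algebra_simps)

lemma ceval_mult: "ceval (f * g) x y = ceval f x y * ceval g x y"
  by (induction f) (simp_all add: ceval_add ceval_smult algebra_simps)

lemma ceval_sum: "ceval (sum F A) x y = (\<Sum>a\<in>A. ceval (F a) x y)"
  by (induction A rule: infinite_finite_induct) (simp_all add: ceval_add)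

lemma ceval_monom: "ceval (monom (monom r i) j) x y = of_real r * x ^ i * y ^ j"
proof -
  have "cpoly (monom r i) = monom (of_real r) i"
    by (simp add: poly_eq_iff)
  moreover have "specialize (monom (monom r i) j) x = monom (poly (cpoly (monom r i)) x) j"
    by (auto simp add: poly_eq_iff)
  ultimately show ?thesis by (simp add: ceval_def poly_monom)
qed

lemma ceval_of_real: "ceval f (of_real x) (of_real y) = of_real (eval2 f x y)"
  unfolding eval2_def
  by (induction f) (simp_all add: map_poly_pCons poly_cpoly_of_real)

text \<open>The chain rule in two variables. Since y is the outer variable,
  \<open>map_poly pderiv f\<close> is the partial derivative by x and \<open>pderiv f\<close> the
  one by y.\<close>

lemma has_field_derivative_ceval:
  fixes x y :: "complex \<Rightarrow> complex"
  assumes x: "(x has_field_derivative x') (at t)" and y: "(y has_field_derivative y') (at t)"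
  shows "((\<lambda>s. ceval f (x s) (y s)) has_field_derivative
    ceval (map_poly pderiv f) (x t) (y t) * x' + ceval (pderiv f) (x t) (y t) * y') (at t)"
proof (induction f)
  case 0
  then show ?case by simp
next
  case (pCons a f)
  have "((\<lambda>s. poly (cpoly a) (x s)) has_field_derivative poly (cpoly (pderiv a)) (x t) * x') (at t)"
    unfolding cpoly_pderiv using DERIV_chain2[OF poly_DERIV x] by simp
  from DERIV_add[OF this DERIV_mult[OF y pCons.IH]]
  show ?case
    by (simp add: map_poly_pCons pderiv_pCons ceval_add algebra_simps)
qed

subsection \<open>Elimination\<close>

text \<open>An element of least degree in the ideal generated by f and h pseudo-divides
  both f and h; if it had positive degree, f would have to divide it, hence h.\<close>

lemma prime_elem_elimination:
  fixes f h :: "'a :: {factorial_ring_gcd, semiring_gcd_mult_normalize} poly"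
  assumes f: "prime_elem f" "degree f > 0" and h: "\<not> f dvd h"
  obtains u v r where "r \<noteq> 0" "u * f + v * h = [:r:]"
proof -
  define J where "J = {e. e \<noteq> 0 \<and> (\<exists>u v. e = u * f + v * h)}"
  have "f \<in> J"
  proof -
    have "f = 1 * f + 0 * h" "f \<noteq> 0" using f(2) by auto
    then show ?thesis unfolding J_def by blast
  qed
  then obtain e where e: "e \<in> J" and min: "\<And>e'. e' \<in> J \<Longrightarrow> degree e \<le> degree e'"
    using ex_has_least_nat[of "\<lambda>e. e \<in> J" f degree] by blast
  obtain u v where uv: "e = u * f + v * h" and e0: "e \<noteq> 0"
    using e by (auto simp: J_def)
  have pseudo: "\<exists>a q. a \<noteq> 0 \<and> smult a g = e * q" if g: "g = s * f + w * h" for g s w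
  proof -
    define r where "r = pseudo_mod g e"
    obtain a q where aq: "a \<noteq> 0" "smult a g = e * q + r"
      using pseudo_mod(1)[OF e0, of g] by (auto simp: r_def)
    have "r = smult a g - e * q" using aq by simp
    also have "\<dots> = (smult a s - q * u) * f + (smult a w - q * v) * h"
      by (simp add: g uv algebra_simps smult_add_right)
    finally have "r = 0 \<or> r \<in> J" unfolding J_def by blast
    moreover have "r = 0 \<or> degree r < degree e"
      unfolding r_def by (rule pseudo_mod(2)[OF e0])
    ultimately have "r = 0" using min by force
    with aq show ?thesis by auto
  qed
  obtain a q where aq: "a \<noteq> 0" "smult a f = e * q"
    using pseudo[of f 1 0] by auto
  obtain b q' where bq: "b \<noteq> 0" "smult b h = e * q'"
    using pseudo[of h 0 1] by auto
  have "f dvd e * q" by (metis aq(2) dvd_refl dvd_smult)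
  then consider "f dvd e" | "f dvd q" using f(1) prime_elem_dvd_multD by blast
  then have "degree e = 0"
  proof cases
    case 1
    then have "f dvd [:b:] * h" using bq(2) by simp
    then have "f dvd [:b:]" using f(1) h prime_elem_dvd_multD by blast
    then have "degree f \<le> degree [:b:]" using bq(1) by (intro dvd_imp_degree_le) auto
    then show ?thesis using f(2) by simp
  next
    case 2
    then obtain k where "q = f * k" by blast
    then have "f * (e * k) = f * [:a:]" using aq(2) by (simp add: algebra_simps)
    moreover have "f \<noteq> 0" using f(2) by auto
    ultimately have "e * k = [:a:]" by (metis mult_cancel_left)
    then have "degree (e * k) = 0" and "e * k \<noteq> 0" using aq(1) by auto
    then show ?thesis by (auto simp: degree_mult_eq)
  qed
  then obtain r where "e = [:r:]" by (metis degree_0_id degree_eq_zeroE)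
  then show thesis using that[of r u v] uv e0 by auto
qed

subsection \<open>Underdetermined linear systems\<close>

text \<open>Gaussian elimination by induction on the equations: equation b is solved for an unknown
  \<open>a0\<close> with nonzero pivot, and \<open>M'\<close> is the system after \<open>a0\<close>
  has been eliminated.\<close>

lemma underdetermined_linear_system:
  fixes M :: "'a \<Rightarrow> 'b \<Rightarrow> 'k :: field"
  assumes "finite B" "finite A" "card B < card A"
  shows "\<exists>c. (\<exists>a\<in>A. c a \<noteq> 0) \<and> (\<forall>b\<in>B. (\<Sum>a\<in>A. c a * M a b) = 0)"
  using assms
proof (induction B arbitrary: A M rule: finite_induct)
  case empty
  then show ?case by (intro exI[of _ "\<lambda>_. 1"]) (auto simp: card_gt_0_iff)
next
  case (insert b B)
  show ?case
  proof (cases "\<exists>a0\<in>A. M a0 b \<noteq> 0")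
    case False
    have "card B < card A" using insert by simp
    from insert.IH[OF insert.prems(1) this, of M] False show ?thesis by auto
  next
    case True
    then obtain a0 where a0: "a0 \<in> A" "M a0 b \<noteq> 0" by blast
    define A' where "A' = A - {a0}"
    have A: "A = insert a0 A'" "a0 \<notin> A'" "finite A'"
      using a0 insert.prems by (auto simp: A'_def)
    define M' where "M' = (\<lambda>a b'. M a b' - M a b * M a0 b' / M a0 b)"
    have "card B < card A'" using insert A by simp
    from insert.IH[OF A(3) this, of M'] obtain c where
      c: "\<exists>a\<in>A'. c a \<noteq> 0" "\<And>b'. b' \<in> B \<Longrightarrow> (\<Sum>a\<in>A'. c a * M' a b') = 0" by blast
    define d where "d = c(a0 := - (\<Sum>a\<in>A'. c a * M a b) / M a0 b)"
    have d: "(\<Sum>a\<in>A. d a * M a b') = (\<Sum>a\<in>A'. c a * M' a b')" for b'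
    proof -
      have "(\<Sum>a\<in>A'. d a * M a b') = (\<Sum>a\<in>A'. c a * M a b')"
        using A by (intro sum.cong) (auto simp: d_def)
      then have "(\<Sum>a\<in>A. d a * M a b')
          = (\<Sum>a\<in>A'. c a * M a b') - (\<Sum>a\<in>A'. c a * M a b) / M a0 b * M a0 b'"
        using A by (simp add: d_def)
      also have "\<dots> = (\<Sum>a\<in>A'. c a * M' a b')"
        by (simp add: M'_def algebra_simps sum_subtractf sum_distrib_left sum_distrib_right
            sum_divide_distrib)
      finally show ?thesis .
    qed
    have "M' a b = 0" for a using a0 by (simp add: M'_def)
    then have "\<forall>b'\<in>insert b B. (\<Sum>a\<in>A. d a * M a b') = 0"
      using c(2) by (auto simp: d)
    moreover have "\<exists>a\<in>A. d a \<noteq> 0" using c(1) A by (auto simp: d_def)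
    ultimately show ?thesis by blast
  qed
qed

subsection \<open>Growth of polynomials\<close>

lemma norm_poly_le_1_plus_power:
  fixes P :: "complex poly"
  assumes "degree P \<le> N"
  shows "\<exists>M>0. \<forall>t. norm (poly P t) \<le> M * (1 + norm t ^ N)"
proof (intro exI[of _ "1 + (\<Sum>i\<le>degree P. norm (coeff P i))"] conjI allI)
  show "0 < 1 + (\<Sum>i\<le>degree P. norm (coeff P i))"
    by (intro add_pos_nonneg sum_nonneg) auto
  fix t :: complex
  have pow: "norm t ^ i \<le> 1 + norm t ^ N" if "i \<le> degree P" for i
  proof (cases "norm t \<le> 1")
    case True
    then have "norm t ^ i \<le> 1" by (simp add: power_le_one)
    then show ?thesis by (simp add: add_increasing2)
  next
    case False
    then have "norm t ^ i \<le> norm t ^ N" using that assms by (intro power_increasing) auto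
    then show ?thesis by simp
  qed
  have "norm (poly P t) \<le> (\<Sum>i\<le>degree P. norm (coeff P i) * norm t ^ i)"
    unfolding poly_altdef by (intro sum_norm_le) (simp add: norm_mult norm_power)
  also have "\<dots> \<le> (\<Sum>i\<le>degree P. norm (coeff P i) * (1 + norm t ^ N))"
    by (intro sum_mono mult_left_mono pow) auto
  also have "\<dots> \<le> (1 + (\<Sum>i\<le>degree P. norm (coeff P i))) * (1 + norm t ^ N)"
    by (simp add: sum_distrib_right[symmetric] distrib_right add_nonneg_nonneg)
  finally show "norm (poly P t) \<le> (1 + (\<Sum>i\<le>degree P. norm (coeff P i))) * (1 + norm t ^ N)" .
qed

text \<open>For large t the leading term of Q dominates. On the remaining disc the bracket attains a
  positive minimum: \<open>norm t ^ K\<close> takes care of the zeros of Q and itself vanishes only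
  at 0, where Q does not.\<close>

lemma one_plus_power_le_norm_poly:
  fixes Q :: "complex poly"
  assumes Q: "coeff Q 0 \<noteq> 0" and K: "0 < K"
  shows "\<exists>M>0. \<forall>t. 1 + norm t ^ degree Q \<le> M * (norm t ^ K + norm (poly Q t))"
proof -
  define N where "N = degree Q"
  define l where "l = norm (lead_coeff Q)"
  have l: "l > 0" using Q by (auto simp: l_def)
  have "((\<lambda>t. norm (poly Q t / t ^ N)) \<longlongrightarrow> l) at_infinity"
    unfolding N_def l_def by (intro tendsto_norm poly_divide_tendsto_aux)
  then have "\<forall>\<^sub>F t in at_infinity. norm (poly Q t / t ^ N) > l / 2"
    by (rule order_tendstoD) (use l in auto)
  then obtain R0 where R0: "\<And>t. norm t \<ge> R0 \<Longrightarrow> norm (poly Q t / t ^ N) > l / 2"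
    unfolding eventually_at_infinity by blast
  define R where "R = max 1 R0"
  have R: "R \<ge> 1" by (simp add: R_def)
  have big: "norm t ^ N \<le> 2 / l * norm (poly Q t)" if "norm t \<ge> R" for t
  proof -
    have "norm t > 0" using that R by linarith
    then show ?thesis
      using R0[of t] that l by (simp add: R_def norm_divide norm_power field_simps)
  qed
  have "continuous_on (cball 0 R) (\<lambda>t. norm t ^ K + norm (poly Q t))"
    by (intro continuous_intros)
  moreover have "cball (0::complex) R \<noteq> {}" using R by simp
  ultimately obtain t0 where t0: "\<And>t. t \<in> cball 0 R \<Longrightarrow>
      norm t0 ^ K + norm (poly Q t0) \<le> norm t ^ K + norm (poly Q t)"
    using continuous_attains_inf[OF compact_cball] by blast
  define e where "e = norm t0 ^ K + norm (poly Q t0)"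
  have e: "e > 0"
  proof (cases "t0 = 0")
    case True
    then show ?thesis using Q K by (simp add: e_def poly_0_coeff_0 zero_power)
  next
    case False
    then show ?thesis by (simp add: e_def add_pos_nonneg)
  qed
  \<comment> \<open>The first summand serves the disc of radius R, the second its complement, where
    1 is absorbed into \<open>norm t ^ N\<close>.\<close>
  define M where "M = (1 + R ^ N) / e + 4 / l"
  have M: "M > 0" using e l R by (auto simp: M_def intro!: add_pos_pos divide_pos_pos)
  have "1 + norm t ^ N \<le> M * (norm t ^ K + norm (poly Q t))" (is "_ \<le> M * ?v") for t
  proof (cases "norm t \<le> R")
    case True
    then have ev: "e \<le> ?v" using t0[of t] by (simp add: e_def)
    have "1 + norm t ^ N \<le> 1 + R ^ N" using True by (simp add: power_mono)
    also have "\<dots> = (1 + R ^ N) / e * e" using e by simp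
    also have "\<dots> \<le> (1 + R ^ N) / e * ?v" using ev e R by (intro mult_left_mono) auto
    also have "\<dots> \<le> M * ?v" using l ev e by (intro mult_right_mono) (auto simp: M_def)
    finally show ?thesis .
  next
    case False
    then have "1 \<le> norm t ^ N" using R by (intro one_le_power) auto
    then have "1 + norm t ^ N \<le> 2 * norm t ^ N" by simp
    also have "\<dots> \<le> 4 / l * norm (poly Q t)" using big[of t] False by simp
    also have "\<dots> \<le> 4 / l * ?v" using l by (intro mult_left_mono) auto
    also have "\<dots> \<le> M * ?v" using l e R by (intro mult_right_mono) (auto simp: M_def)
    finally show ?thesis .
  qed
  with M show ?thesis unfolding N_def by blast
qed

text \<open>The degree condition controls the growth at infinity, the nonzero constant coefficient
  of Q the pole at 0. Used in both directions, this makes the two coordinates of a curve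
  comparable.\<close>

lemma laurent_comparison:
  fixes P Q :: "complex poly"
  assumes "degree P \<le> degree Q" "coeff Q 0 \<noteq> 0" "0 < K"
  obtains M where "M > 0" "\<And>t. t \<noteq> 0 \<Longrightarrow> norm (poly P t / t ^ K) \<le> M * (1 + norm (poly Q t / t ^ K))"
proof -
  obtain A where A: "A > 0" "\<And>t. norm (poly P t) \<le> A * (1 + norm t ^ degree Q)"
    using norm_poly_le_1_plus_power[OF assms(1)] by blast
  obtain B where B: "B > 0" "\<And>t. 1 + norm t ^ degree Q \<le> B * (norm t ^ K + norm (poly Q t))"
    using one_plus_power_le_norm_poly[OF assms(2,3)] by blast
  show thesis
  proof
    show "A * B > 0" using A B by simp
    fix t :: complex assume t: "t \<noteq> 0"
    have "norm (poly P t) \<le> A * (B * (norm t ^ K + norm (poly Q t)))"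
      using A(2)[of t] B(2)[of t] A(1) by (meson mult_left_mono less_imp_le order_trans)
    then show "norm (poly P t / t ^ K) \<le> A * B * (1 + norm (poly Q t / t ^ K))"
      using t by (simp add: norm_divide norm_power field_simps)
  qed
qed

text \<open>Vieta with a crude constant: each new factor turns a coefficient into a difference of
  two terms with the same bound, which at most doubles it. For j above \<open>card I\<close> the
  coefficient is 0 and the truncated exponent is 0.\<close>

lemma norm_coeff_prod_linear_le:
  fixes z :: "'i \<Rightarrow> complex"
  assumes "finite I" "\<And>i. i \<in> I \<Longrightarrow> norm (z i) \<le> A" "A \<ge> 0"
  shows "norm (coeff (\<Prod>i\<in>I. [:- z i, 1:]) j) \<le> 2 ^ card I * A ^ (card I - j)"
  using assms
proof (induction I arbitrary: j rule: finite_induct)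
  case empty
  then show ?case by (cases j) auto
next
  case (insert a I)
  let ?P = "\<Prod>i\<in>I. [:- z i, 1:]"
  have IH: "norm (coeff ?P j) \<le> 2 ^ card I * A ^ (card I - j)" for j
    using insert by auto
  have "norm (z a * coeff ?P j) \<le> 2 ^ card I * A ^ (Suc (card I) - j)"
  proof (cases "j \<le> card I")
    case True
    have "norm (z a * coeff ?P j) \<le> A * (2 ^ card I * A ^ (card I - j))"
      unfolding norm_mult using insert.prems IH by (intro mult_mono) auto
    then show ?thesis using True by (simp add: Suc_diff_le mult_ac)
  next
    case False
    have "degree ?P = card I" by (simp add: degree_prod_sum_eq)
    then have "coeff ?P j = 0" using False by (intro coeff_eq_0) simp
    then show ?thesis using insert.prems by simp
  qed
  moreover have "norm (coeff (pCons 0 ?P) j) \<le> 2 ^ card I * A ^ (Suc (card I) - j)"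
    using IH[of "j - 1"] insert.prems by (cases j) auto
  ultimately have "norm (coeff (pCons 0 ?P) j - z a * coeff ?P j)
      \<le> 2 * (2 ^ card I * A ^ (Suc (card I) - j))"
    using norm_triangle_ineq4[of "coeff (pCons 0 ?P) j" "z a * coeff ?P j"] by linarith
  moreover have "coeff ([:- z a, 1:] * ?P) j = coeff (pCons 0 ?P) j - z a * coeff ?P j"
    by (simp add: mult.commute)
  ultimately show ?case using insert.hyps by (simp add: mult.assoc)
qed

lemma eventually_at_infinity_not_in_finite:
  fixes S :: "complex set"
  assumes "finite S"
  shows "\<forall>\<^sub>F x in at_infinity. x \<notin> S"
proof -
  obtain B where B: "\<And>x. x \<in> S \<Longrightarrow> norm x \<le> B"
    using finite_imp_bounded[OF assms] unfolding bounded_iff by blast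
  show ?thesis
    unfolding eventually_at_infinity
  proof (intro exI[of _ "B + 1"] allI impI)
    fix x :: complex assume "norm x \<ge> B + 1"
    then show "x \<notin> S" using B[of x] by auto
  qed
qed

text \<open>If the degree exceeded k, the quotient of \<open>x ^ k\<close> by P would tend to 0 at
  infinity, against the assumed bound.\<close>

lemma degree_le_of_growth:
  fixes P :: "complex poly"
  assumes "\<forall>\<^sub>F x in at_infinity. norm (poly P x) \<le> B * (1 + norm x) ^ k"
  shows "degree P \<le> k"
proof (rule ccontr)
  assume "\<not> degree P \<le> k"
  then have lt: "degree (monom 1 k :: complex poly) < degree P" by (simp add: degree_monom_eq)
  \<comment> \<open>As 1 + |x| is at most 2|x| once |x| is at least 1, any constant above
    \<open>\<bar>B\<bar> * 2 ^ k\<close> gives the contradiction.\<close>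
  define q where "q = \<bar>B\<bar> * 2 ^ k + 1"
  have q: "q > 0" by (simp add: q_def add_nonneg_pos)
  have "((\<lambda>x. norm (poly (monom 1 k) x / poly P x)) \<longlongrightarrow> norm (0 :: complex)) at_infinity"
    by (intro tendsto_norm poly_divide_tendsto_0_at_infinity lt)
  then have "\<forall>\<^sub>F x in at_infinity. norm (poly (monom 1 k) x / poly P x) < 1 / q"
    by (rule order_tendstoD) (use q in auto)
  moreover have "\<forall>\<^sub>F x in at_infinity. poly P x \<noteq> 0"
    using eventually_at_infinity_not_in_finite[OF poly_roots_finite[of P]] lt by (cases "P = 0") auto
  moreover have "\<forall>\<^sub>F x :: complex in at_infinity. norm x \<ge> 1"
    unfolding eventually_at_infinity by blast
  ultimately have "\<forall>\<^sub>F x :: complex in at_infinity. False"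
    using assms
  proof eventually_elim
    case (elim x)
    have "q * norm x ^ k < norm (poly P x)"
      using elim(1,2) q by (simp add: poly_monom norm_divide norm_power field_simps)
    also have "\<dots> \<le> \<bar>B\<bar> * (1 + norm x) ^ k"
      using elim(4) by (rule order_trans) (intro mult_right_mono, auto)
    also have "\<dots> \<le> \<bar>B\<bar> * (2 * norm x) ^ k"
      using elim(3) by (intro mult_left_mono power_mono) auto
    finally show False
      using zero_le_power[of "norm x" k] by (simp add: q_def algebra_simps power_mult_distrib)
  qed
  then show False by (simp add: eventually_False trivial_limit_at_infinity)
qed

lemma degree_ge_of_growth:
  fixes P :: "complex poly"
  assumes "b > 0" "\<forall>\<^sub>F x in at_infinity. b * norm x ^ k \<le> norm (poly P x)"
  shows "k \<le> degree P"
proof (rule ccontr)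
  assume "\<not> k \<le> degree P"
  then have lt: "degree P < degree (monom 1 k :: complex poly)" by (simp add: degree_monom_eq)
  have "((\<lambda>x. norm (poly P x / poly (monom 1 k) x)) \<longlongrightarrow> norm (0 :: complex)) at_infinity"
    by (intro tendsto_norm poly_divide_tendsto_0_at_infinity lt)
  then have "\<forall>\<^sub>F x in at_infinity. norm (poly P x / poly (monom 1 k) x) < b"
    using assms(1) by (auto dest: order_tendstoD)
  moreover have "\<forall>\<^sub>F x :: complex in at_infinity. norm x \<ge> 1"
    unfolding eventually_at_infinity by blast
  ultimately have "\<forall>\<^sub>F x :: complex in at_infinity. False"
    using assms(2)
  proof eventually_elim
    case (elim x)
    have "norm x > 0" using elim(2) by linarith
    then have "norm (poly P x) < b * norm x ^ k"
      using elim(1) by (simp add: poly_monom norm_divide norm_power field_simps)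
    with elim(3) show False by simp
  qed
  then show False by (simp add: eventually_False trivial_limit_at_infinity)
qed

lemma eventually_at_not_in_finite:
  fixes S :: "complex set"
  assumes "finite S"
  shows "\<forall>\<^sub>F x in at a. x \<notin> S"
proof -
  have "open (- (S - {a}))" using assms by (intro open_Compl finite_imp_closed) auto
  then have "\<forall>\<^sub>F x in at a. x \<in> - (S - {a})" by (intro eventually_at_in_open') auto
  moreover have "\<forall>\<^sub>F x in at a. x \<noteq> a" by (simp add: eventually_at_filter)
  ultimately show ?thesis by eventually_elim auto
qed

subsection \<open>Curves parametrized by Laurent polynomials\<close>

text \<open>The operator t d/dt on the Laurent polynomial \<open>P / t ^ K\<close>, written on
  numerators; it multiplies the coefficient of \<open>t ^ j\<close> in P by j - K.\<close>

definition euler :: "nat \<Rightarrow> complex poly \<Rightarrow> complex poly" where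
  "euler K P = pCons 0 (pderiv P) - smult (of_nat K) P"

lemma coeff_euler: "coeff (euler K P) j = (of_nat j - of_nat K) * coeff P j"
  by (cases j) (auto simp: euler_def coeff_pderiv algebra_simps)

lemma euler_combination:
  "euler K (smult \<alpha> P + smult \<beta> Q) = smult \<alpha> (euler K P) + smult \<beta> (euler K Q)"
  by (simp add: poly_eq_iff coeff_euler algebra_simps)

lemma has_field_derivative_laurent:
  assumes "t \<noteq> 0"
  shows "((\<lambda>s. poly P s / s ^ K) has_field_derivative poly (euler K P) t / t ^ Suc K) (at t)"
proof -
  have "((\<lambda>s. poly P s / s ^ K) has_field_derivative
      (poly (pderiv P) t * t ^ K - poly P t * (of_nat K * t ^ (K - 1))) / (t ^ K * t ^ K)) (at t)"
    using assms by (auto intro!: derivative_eq_intros)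
  also have "(poly (pderiv P) t * t ^ K - poly P t * (of_nat K * t ^ (K - 1))) / (t ^ K * t ^ K)
      = poly (euler K P) t / t ^ Suc K"
    using assms by (cases K) (auto simp: euler_def field_simps)
  finally show ?thesis .
qed

text \<open>Supplies infinitely many parameters with real image points, from which identities spread
  to all nonzero t.\<close>

lemma infinite_arc: "infinite (cis ` {-pi..pi})"
proof
  assume "finite (cis ` {-pi..pi})"
  then have "finite (cis ` {0..pi})" by (rule finite_subset[rotated]) auto
  then have "finite (Re ` cis ` {0..pi})" by (rule finite_imageI)
  then have "finite (cos ` {0..pi})" by (simp add: image_image)
  moreover have "inj_on cos {0..pi}" by (auto intro!: inj_onI cos_inj_pi)
  ultimately have "finite {0..pi}" by (rule finite_imageD)
  then show False using infinite_Icc[of 0 pi] by simp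
qed

text \<open>The coordinates \<open>X / t ^ K\<close> and \<open>Y / t ^ K\<close> have poles of
  exact order K at 0 and N - K at infinity. N is thus the degree of each coordinate as a map of the
  Riemann sphere.\<close>

locale laurent_curve =
  fixes X Y :: "complex poly" and K N :: nat
  assumes K: "0 < K" "K < N"
    and degree_X: "degree X = N" and degree_Y: "degree Y = N"
    and coeff_0_X: "coeff X 0 \<noteq> 0" and coeff_0_Y: "coeff Y 0 \<noteq> 0"
    and real_X: "\<And>\<theta>. poly X (cis \<theta>) / cis \<theta> ^ K \<in> \<real>"
    and real_Y: "\<And>\<theta>. poly Y (cis \<theta>) / cis \<theta> ^ K \<in> \<real>"
begin

definition x :: "complex \<Rightarrow> complex" where "x t = poly X t / t ^ K"
definition y :: "complex \<Rightarrow> complex" where "y t = poly Y t / t ^ K"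

text \<open>Vanishing is required at all nonzero complex parameters and not just on the unit circle,
  so that surjectivity of x and derivatives in t can be used.\<close>

definition vanish :: "real poly poly \<Rightarrow> bool" where
  "vanish g \<longleftrightarrow> (\<forall>t. t \<noteq> 0 \<longrightarrow> ceval g (x t) (y t) = 0)"

lemma euler_X_nonzero: "euler K X \<noteq> 0"
proof -
  have "coeff X N \<noteq> 0" using degree_X coeff_0_X by (metis coeff_0 leading_coeff_neq_0)
  then have "coeff (euler K X) N \<noteq> 0" using K by (simp add: coeff_euler)
  then show ?thesis by auto
qed

text \<open>Horner induction: each further coefficient costs one more factor \<open>t ^ K\<close> to
  clear the pole at 0.\<close>

lemma x_poly_laurent: "\<exists>k Q. \<forall>t. t \<noteq> 0 \<longrightarrow> t ^ k * poly (cpoly a) (x t) = poly Q t"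
proof (induction a)
  case 0
  then show ?case by (intro exI[of _ 0]) auto
next
  case (pCons r a)
  then obtain k Q where Q: "\<And>t. t \<noteq> 0 \<Longrightarrow> t ^ k * poly (cpoly a) (x t) = poly Q t" by blast
  have "t ^ (k + K) * poly (cpoly (pCons r a)) (x t) = poly (monom (of_real r) (k + K) + X * Q) t"
    if t: "t \<noteq> 0" for t
  proof -
    have "poly X t = t ^ K * x t" using t by (simp add: x_def)
    then show ?thesis by (simp add: Q[OF t, symmetric] poly_monom power_add distrib_left mult_ac)
  qed
  then show ?case by blast
qed

lemma ceval_laurent: "\<exists>k Q. \<forall>t. t \<noteq> 0 \<longrightarrow> t ^ k * ceval g (x t) (y t) = poly Q t"
proof (induction g)
  case 0
  then show ?case by (intro exI[of _ 0]) auto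
next
  case (pCons a g)
  then obtain k Q where Q: "\<And>t. t \<noteq> 0 \<Longrightarrow> t ^ k * ceval g (x t) (y t) = poly Q t" by blast
  obtain l R where R: "\<And>t. t \<noteq> 0 \<Longrightarrow> t ^ l * poly (cpoly a) (x t) = poly R t"
    using x_poly_laurent by blast
  have "t ^ (k + l + K) * ceval (pCons a g) (x t) (y t)
      = poly (monom 1 (k + K) * R + monom 1 l * Y * Q) t"
    if t: "t \<noteq> 0" for t
  proof -
    have "poly Y t = t ^ K * y t" using t by (simp add: y_def)
    then show ?thesis
      by (simp add: Q[OF t, symmetric] R[OF t, symmetric] poly_monom power_add distrib_left mult_ac)
  qed
  then show ?case by blast
qed

text \<open>After the pole at 0 is cleared, the values of g on the curve form a polynomial in t,
  which is 0 once it has infinitely many roots.\<close>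

lemma vanishI_infinite:
  assumes "infinite T" "\<And>t. t \<in> T \<Longrightarrow> t \<noteq> 0" "\<And>t. t \<in> T \<Longrightarrow> ceval g (x t) (y t) = 0"
  shows "vanish g"
proof -
  obtain k Q where Q: "\<And>t. t \<noteq> 0 \<Longrightarrow> t ^ k * ceval g (x t) (y t) = poly Q t"
    using ceval_laurent by blast
  have "T \<subseteq> {t. poly Q t = 0}" 
    using assms(2,3) by (auto simp: Q[symmetric])
  then have "infinite {t. poly Q t = 0}" using assms(1) finite_subset by blast
  then have "Q = 0" using poly_roots_finite by blast
  then show ?thesis using Q by (auto simp: vanish_def)
qed

text \<open>The vanishing ideal is prime: of two factors with product 0 on the curve, one is 0 at
  infinitely many parameters.\<close>

lemma vanish_mult:
  assumes "vanish (g * h)"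
  shows "vanish g \<or> vanish h"
proof -
  have "- {0 :: complex} \<subseteq> {t. t \<noteq> 0 \<and> ceval g (x t) (y t) = 0} \<union> {t. t \<noteq> 0 \<and> ceval h (x t) (y t) = 0}"
    using assms by (auto simp: vanish_def ceval_mult)
  moreover have "infinite (- {0 :: complex})"
    by (metis finite_compl infinite_UNIV_char_0 finite.emptyI finite.insertI)
  ultimately have "infinite {t. t \<noteq> 0 \<and> ceval g (x t) (y t) = 0} \<or>
      infinite {t. t \<noteq> 0 \<and> ceval h (x t) (y t) = 0}"
    by (meson finite_Un finite_subset)
  then show ?thesis by (auto intro: vanishI_infinite)
qed

lemma vanish_dvd: "vanish g" if "f dvd g" "vanish f"
  using that by (auto simp: vanish_def ceval_mult)

text \<open>Links the complex notion to the real point set of the curve: x and y are real on the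
  unit circle, and the circle is infinite.\<close>

lemma vanish_iff:
  "vanish g \<longleftrightarrow> (\<forall>\<theta>\<in>{-pi..pi}. eval2 g (Re (x (cis \<theta>))) (Re (y (cis \<theta>))) = 0)"
proof -
  have real: "ceval g (x (cis \<theta>)) (y (cis \<theta>)) = of_real (eval2 g (Re (x (cis \<theta>))) (Re (y (cis \<theta>))))" for \<theta>
    using ceval_of_real[of g "Re (x (cis \<theta>))" "Re (y (cis \<theta>))"] real_X[of \<theta>] real_Y[of \<theta>]
    by (simp add: x_def y_def)
  show ?thesis
  proof
    assume "vanish g"
    then have "ceval g (x (cis \<theta>)) (y (cis \<theta>)) = 0" for \<theta> by (simp add: vanish_def)
    then show "\<forall>\<theta>\<in>{-pi..pi}. eval2 g (Re (x (cis \<theta>))) (Re (y (cis \<theta>))) = 0"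
      by (simp add: real)
  next
    assume *: "\<forall>\<theta>\<in>{-pi..pi}. eval2 g (Re (x (cis \<theta>))) (Re (y (cis \<theta>))) = 0"
    show "vanish g"
      by (rule vanishI_infinite[OF infinite_arc]) (use * in \<open>auto simp: real\<close>)
  qed
qed

text \<open>Fibres of x are root sets of polynomials; 0 is never a root because the constant
  coefficient of X survives.\<close>

lemma x_eq_iff: "t \<noteq> 0 \<and> x t = x0 \<longleftrightarrow> poly (X - monom x0 K) t = 0"
proof (cases "t = 0")
  case True
  then show ?thesis using coeff_0_X K by (simp add: poly_monom poly_0_coeff_0)
next
  case False
  then show ?thesis by (auto simp: x_def poly_monom field_simps)
qed

lemma degree_X_minus: "degree (X - monom x0 K) = N"
proof -
  have "degree (X + monom (- x0) K) = degree X"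
    using K degree_X by (intro degree_add_eq_left le_less_trans[OF degree_monom_le]) auto
  then show ?thesis by (simp add: degree_X minus_monom[symmetric])
qed

lemma x_surj: "\<exists>t. t \<noteq> 0 \<and> x t = x0"
proof -
  have "\<not> constant (poly (X - monom x0 K))"
    using K degree_X_minus[of x0] by (simp add: constant_degree)
  then show ?thesis unfolding x_eq_iff by (rule fundamental_theorem_of_algebra)
qed

text \<open>With x-degrees up to \<open>N\<^sup>2\<close> and y-degrees up to N there are more monomials than
  possible exponents of t in their values on the curve.\<close>

lemma vanishing_poly_exists: "\<exists>g. g \<noteq> 0 \<and> degree g \<le> N \<and> vanish g"
proof -
  define d where "d = N ^ 2"
  define A where "A = {..d} \<times> {..N}"
  define B where "B = {..N * (d + N)}"
  \<comment> \<open>This is \<open>x ^ i * y ^ j\<close> times \<open>t ^ (K * (d + N))\<close>, a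
    factor common to all monomials that clears every pole.\<close>
  define F where "F = (\<lambda>(i, j). X ^ i * Y ^ j * monom 1 (K * (d + N - i - j)))"
  \<comment> \<open>The number of monomials, \<open>(N ^ 2 + 1) * (N + 1)\<close>, exceeds the
    number of exponents, \<open>N * (N ^ 2 + N) + 1\<close>, by N.\<close>
  have "card B < card A"
    using K by (simp add: A_def B_def d_def power2_eq_square algebra_simps)
  then obtain c where c: "\<exists>a\<in>A. c a \<noteq> 0" "\<And>b. b \<in> B \<Longrightarrow> (\<Sum>a\<in>A. c a * coeff (F a) b) = 0"
    using underdetermined_linear_system[of B A "\<lambda>a b. coeff (F a) b"] by (auto simp: A_def B_def)
  have deg_F: "degree (F a) \<le> N * (d + N)" if a_in: "a \<in> A" for a
  proof -
    obtain i j where a: "a = (i, j)" "i \<le> d" "j \<le> N" using a_in by (auto simp: A_def)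
    have "degree (F a) \<le> N * i + N * j + K * (d + N - i - j)"
      unfolding a F_def
      by (auto intro!: order_trans[OF degree_mult_le] add_mono order_trans[OF degree_power_le]
          degree_monom_le simp: degree_X degree_Y)
    also have "\<dots> \<le> N * i + N * j + N * (d + N - i - j)" using K by simp
    also have "\<dots> = N * (i + j + (d + N - i - j))" by (simp add: algebra_simps)
    also have "i + j + (d + N - i - j) = d + N" using a by simp
    finally show ?thesis .
  qed
  have sum_F: "(\<Sum>a\<in>A. smult (c a) (F a)) = 0"
  proof (rule poly_eqI)
    fix b
    show "coeff (\<Sum>a\<in>A. smult (c a) (F a)) b = coeff 0 b"
    proof (cases "b \<in> B")
      case True
      then show ?thesis using c(2) by (simp add: coeff_sum)
    next
      case False
      then have "coeff (F a) b = 0" if "a \<in> A" for a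
        using deg_F[OF that] by (intro coeff_eq_0) (auto simp: B_def)
      then show ?thesis by (simp add: coeff_sum)
    qed
  qed
  have poly_F: "(\<Sum>a\<in>A. c a * poly (F a) t) = 0" for t
  proof -
    have "poly (\<Sum>a\<in>A. smult (c a) (F a)) t = 0" unfolding sum_F by simp
    then show ?thesis by (simp add: poly_sum)
  qed
  have zero: "(\<Sum>(i, j)\<in>A. c (i, j) * x t ^ i * y t ^ j) = 0" if t: "t \<noteq> 0" for t
  proof -
    have "c a * poly (F a) t = t ^ (K * (d + N)) * (case a of (i, j) \<Rightarrow> c (i, j) * x t ^ i * y t ^ j)"
      if a_in: "a \<in> A" for a
    proof -
      obtain i j where a: "a = (i, j)" "i \<le> d" "j \<le> N" using a_in by (auto simp: A_def)
      have "K * (d + N) = K * i + K * j + K * (d + N - i - j)"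
        using a by (simp add: distrib_left[symmetric])
      then have "t ^ (K * (d + N)) = (t ^ K) ^ i * (t ^ K) ^ j * t ^ (K * (d + N - i - j))"
        by (simp add: power_add power_mult)
      then show ?thesis
        using t by (simp add: a F_def x_def y_def poly_monom power_divide)
    qed
    then have "t ^ (K * (d + N)) * (\<Sum>(i, j)\<in>A. c (i, j) * x t ^ i * y t ^ j) = 0"
      using poly_F[of t] by (simp add: sum_distrib_left)
    then show ?thesis using t by simp
  qed
  \<comment> \<open>The coefficients found are complex. One of the factors 1 and \<open>\<i>\<close>
    leaves a nonzero real part, and at real points the real parts still satisfy the
    relation.\<close>
  obtain w where w: "\<exists>a\<in>A. Re (w * c a) \<noteq> 0"
  proof -
    obtain a where a: "a \<in> A" "c a \<noteq> 0" using c by blast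
    then show thesis using that[of 1] that[of "\<i>"] by (auto simp: complex_eq_iff)
  qed
  define g where "g = (\<Sum>(i, j)\<in>A. monom (monom (Re (w * c (i, j))) i) j)"
  have coeff_g: "coeff (coeff g j) i = Re (w * c (i, j))" if "(i, j) \<in> A" for i j
  proof -
    have "coeff (coeff g j) i = (\<Sum>a\<in>A. if a = (i, j) then Re (w * c a) else 0)"
      unfolding g_def coeff_sum by (intro sum.cong) (auto split: if_splits)
    then show ?thesis using that by (simp add: A_def)
  qed
  have "g \<noteq> 0" using w coeff_g by force
  moreover have "degree g \<le> N"
    unfolding g_def
    by (intro degree_sum_le) (auto simp: A_def intro: order_trans[OF degree_monom_le])
  moreover have "vanish g"
  proof (rule vanishI_infinite[OF infinite_arc])
    fix t assume "t \<in> cis ` {-pi..pi}"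
    then obtain \<theta> where t: "t = cis \<theta>" by auto
    obtain u v where uv: "x t = of_real u" "y t = of_real v"
      using real_X[of \<theta>] real_Y[of \<theta>] by (auto simp: t x_def y_def elim!: Reals_cases)
    have "(\<Sum>(i, j)\<in>A. Re (w * c (i, j)) * u ^ i * v ^ j)
        = Re (w * (\<Sum>(i, j)\<in>A. c (i, j) * x t ^ i * y t ^ j))"
      unfolding sum_distrib_left Re_sum uv
    proof (intro sum.cong refl, clarify)
      fix i j
      have "w * (c (i, j) * of_real u ^ i * of_real v ^ j) = of_real (u ^ i * v ^ j) * (w * c (i, j))"
        by (simp add: algebra_simps)
      then show "Re (w * c (i, j)) * u ^ i * v ^ j = Re (w * (c (i, j) * of_real u ^ i * of_real v ^ j))"
        by (simp only: times_complex.sel(1)[of "of_real _"] Re_complex_of_real Im_complex_of_real) simp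
    qed
    also have "\<dots> = 0" using zero[of t] by (simp add: t)
    finally have sum0: "(\<Sum>(i, j)\<in>A. Re (w * c (i, j)) * u ^ i * v ^ j) = 0" .
    have "ceval g (x t) (y t) = of_real (\<Sum>(i, j)\<in>A. Re (w * c (i, j)) * u ^ i * v ^ j)"
      unfolding g_def ceval_sum of_real_sum
      by (intro sum.cong) (auto simp: ceval_monom uv)
    then show "ceval g (x t) (y t) = 0" unfolding sum0 by simp
  qed auto
  ultimately show ?thesis by blast
qed

text \<open>A polynomial in x alone that vanishes on the curve has every complex number as a root,
  since x is surjective.\<close>

lemma vanish_const: "vanish [:a:] \<longleftrightarrow> a = 0"
proof
  assume v: "vanish [:a:]"
  have "poly (cpoly a) x0 = 0" for x0
    using x_surj[of x0] v by (auto simp: vanish_def)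
  then have "cpoly a = 0" by (metis poly_all_0_iff_0)
  then show "a = 0" by simp
qed (simp add: vanish_def)

lemma not_vanish_unit: "\<not> vanish g" if "is_unit g"
proof
  assume "vanish g"
  with that have "vanish 1" by (rule vanish_dvd)
  then show False using vanish_const[of 1] by (simp add: pCons_one)
qed

text \<open>Primality of the vanishing ideal passes vanishing from a product to one of its prime
  factors.\<close>

lemma irreducible_vanishing_exists: "\<exists>f. irreducible f \<and> vanish f"
proof -
  obtain g where g: "g \<noteq> 0" "vanish g" using vanishing_poly_exists by blast
  from g show ?thesis
  proof (induction g rule: prime_divisors_induct)
    case (unit g)
    then show ?case using not_vanish_unit by blast
  next
    case (factor q g)
    show ?case
    proof (cases "vanish q")
      case True
      then show ?thesis using factor.hyps by (metis prime_elem_imp_irreducible prime_imp_prime_elem)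
    next
      case False
      then show ?thesis using factor vanish_mult by auto
    qed
  qed auto
qed

section \<open>The generator of the vanishing ideal\<close>

context
  fixes f
  assumes irreducible_f: "irreducible f" and vanish_f: "vanish f"
begin

lemma prime_f: "prime_elem f"
  using irreducible_f by (rule irreducible_imp_prime_elem)

lemma degree_f_pos: "degree f > 0"
proof (rule ccontr)
  assume "\<not> degree f > 0"
  then obtain a where "f = [:a:]" by (metis degree_eq_zeroE gr0I)
  then show False using vanish_f irreducible_f by (auto simp: vanish_const)
qed

text \<open>If h vanished without being a multiple of f, eliminating y from f and h would give a
  nonzero polynomial in x alone that vanishes on the curve.\<close>

lemma vanish_iff_dvd: "vanish h \<longleftrightarrow> f dvd h"
proof
  assume h: "vanish h"
  show "f dvd h"
  proof (rule ccontr)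
    assume "\<not> f dvd h"
    then obtain u v r where r: "r \<noteq> 0" "u * f + v * h = [:r:]"
      using prime_elem_elimination[OF prime_f degree_f_pos] by metis
    have "vanish (u * f + v * h)" using h vanish_f by (simp add: vanish_def ceval_add ceval_mult)
    then show False using r by (simp add: vanish_const)
  qed
qed (use vanish_f vanish_dvd in blast)

lemma degree_f_le: "degree f \<le> N"
proof -
  obtain g where "g \<noteq> 0" "degree g \<le> N" "vanish g" using vanishing_poly_exists by blast
  then show ?thesis using dvd_imp_degree_le[of f g] vanish_iff_dvd by force
qed

end

end

text \<open>The tangents at two parameters with the same image on a curve f = 0 agree at every
  smooth point, so injectivity modulo coincidence of tangents suffices for generic injectivity.\<close>

locale tangent_separated_laurent_curve = laurent_curve +
  fixes E :: "complex set"
  assumes finite_E: "finite E"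
    and tangent_separated: "\<And>s t. s \<noteq> 0 \<Longrightarrow> t \<noteq> 0 \<Longrightarrow> s \<notin> E \<Longrightarrow> t \<notin> E \<Longrightarrow> x s = x t \<Longrightarrow> y s = y t \<Longrightarrow>
      poly (euler K X) s * poly (euler K Y) t = poly (euler K X) t * poly (euler K Y) s \<Longrightarrow> s = t"
begin

section \<open>Fibres of the x-coordinate and generic injectivity\<close>

definition fibre :: "complex \<Rightarrow> complex set" where
  "fibre x0 = {t. t \<noteq> 0 \<and> x t = x0}"

lemma fibre_eq: "fibre x0 = {t. poly (X - monom x0 K) t = 0}"
  unfolding fibre_def x_eq_iff ..

lemma finite_fibre: "finite (fibre x0)"
proof -
  have "X - monom x0 K \<noteq> 0" using degree_X_minus[of x0] K by (metis degree_0 less_nat_zero_code)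
  then show ?thesis unfolding fibre_eq by (rule poly_roots_finite)
qed

text \<open>A multiple root of \<open>X - monom x0 K\<close> is a critical point of x, that is, a
  zero of \<open>euler K X\<close>. Off the critical values all N roots are simple.\<close>

lemma card_fibre:
  assumes "x0 \<notin> x ` {t. poly (euler K X) t = 0}"
  shows "card (fibre x0) = N"
proof -
  let ?P = "X - monom x0 K"
  have "rsquarefree ?P"
    unfolding rsquarefree_roots
  proof (intro allI notI, elim conjE)
    fix t assume 0: "poly ?P t = 0" and 1: "poly (pderiv ?P) t = 0"
    have t: "t \<noteq> 0" "x t = x0" using 0 x_eq_iff by blast+
    have "poly (pderiv X) t = of_nat K * x0 * t ^ (K - 1)"
      using 1 by (simp add: pderiv_diff pderiv_monom poly_monom)
    then have "t * poly (pderiv X) t = of_nat K * (x0 * t ^ K)"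
      using K by (cases K) auto
    moreover have "poly X t = x0 * t ^ K" using 0 by (simp add: poly_monom)
    ultimately have "poly (euler K X) t = 0" by (simp add: euler_def)
    then show False using assms t by auto
  qed
  then have "?P = smult (lead_coeff ?P) (\<Prod>z | poly ?P z = 0. [:- z, 1:])"
    by (rule complex_poly_decompose_rsquarefree[symmetric])
  moreover have "?P \<noteq> 0" using degree_X_minus[of x0] K by (metis degree_0 less_nat_zero_code)
  then have "lead_coeff ?P \<noteq> 0" by (rule leading_coeff_neq_0)
  ultimately have "degree ?P = degree (\<Prod>z\<in>fibre x0. [:- z, 1:])"
    by (metis degree_smult_eq fibre_eq)
  then show ?thesis by (simp add: degree_X_minus degree_prod_sum_eq)
qed

context
  fixes f
  assumes irreducible_f: "irreducible f" and vanish_f: "vanish f"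
begin

text \<open>Differentiating f(x(t), y(t)) = 0: the gradient of f is normal to the velocity, whose
  common denominator \<open>t ^ Suc K\<close> drops out.\<close>

lemma tangent_equation:
  assumes "t \<noteq> 0"
  shows "ceval (map_poly pderiv f) (x t) (y t) * poly (euler K X) t
    + ceval (pderiv f) (x t) (y t) * poly (euler K Y) t = 0"
proof -
  let ?A = "ceval (map_poly pderiv f) (x t) (y t)" and ?B = "ceval (pderiv f) (x t) (y t)"
  have "(x has_field_derivative poly (euler K X) t / t ^ Suc K) (at t)"
    and "(y has_field_derivative poly (euler K Y) t / t ^ Suc K) (at t)"
    unfolding x_def[abs_def] y_def[abs_def] using assms by (rule has_field_derivative_laurent)+
  from has_field_derivative_ceval[OF this, of f]
  have "((\<lambda>s. ceval f (x s) (y s)) has_field_derivative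
      ?A * (poly (euler K X) t / t ^ Suc K) + ?B * (poly (euler K Y) t / t ^ Suc K)) (at t)" .
  moreover have "((\<lambda>s. ceval f (x s) (y s)) has_field_derivative 0) (at t)"
  proof (rule has_field_derivative_transform_within_open[of "\<lambda>_. 0" _ _ "- {0}"])
    show "0 = ceval f (x s) (y s)" if "s \<in> - {0}" for s
      using that vanish_f by (simp add: vanish_def)
  qed (use assms in auto)
  ultimately have "?A * (poly (euler K X) t / t ^ Suc K) + ?B * (poly (euler K Y) t / t ^ Suc K) = 0"
    by (rule DERIV_unique)
  then show ?thesis using assms by (simp add: field_simps)
qed

lemma generic_fibre_injective:
  obtains S where "finite S" "\<And>x0. x0 \<notin> S \<Longrightarrow> poly (cpoly (lead_coeff f)) x0 \<noteq> 0"
    "\<And>x0. x0 \<notin> S \<Longrightarrow> card (fibre x0) = N" "\<And>x0. x0 \<notin> S \<Longrightarrow> inj_on y (fibre x0)"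
proof -
  note deg_pos = degree_f_pos[OF irreducible_f vanish_f]
  note prime = prime_f[OF irreducible_f vanish_f]
  have "\<not> f dvd pderiv f"
  proof
    assume "f dvd pderiv f"
    moreover have "pderiv f \<noteq> 0" using deg_pos by (simp add: pderiv_eq_0_iff)
    ultimately have "degree f \<le> degree (pderiv f)" by (rule dvd_imp_degree_le)
    then show False using deg_pos by (simp add: degree_pderiv)
  qed
  \<comment> \<open>The polynomial r in x alone plays the role of a discriminant: away from its
    roots the y-derivative of f is nonzero on the curve.\<close>
  then obtain u v r where r: "r \<noteq> 0" "u * f + v * pderiv f = [:r:]"
    using prime_elem_elimination[OF prime deg_pos] by metis
  have smooth: "ceval (pderiv f) (x t) (y t) \<noteq> 0"
    if "t \<noteq> 0" "poly (cpoly r) (x t) \<noteq> 0" for t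
  proof
    assume "ceval (pderiv f) (x t) (y t) = 0"
    moreover have "ceval f (x t) (y t) = 0" using that vanish_f by (simp add: vanish_def)
    ultimately have "ceval (u * f + v * pderiv f) (x t) (y t) = 0"
      by (simp add: ceval_add ceval_mult)
    then show False unfolding r using that by simp
  qed
  define S where "S = {x0. poly (cpoly (lead_coeff f)) x0 = 0} \<union> {x0. poly (cpoly r) x0 = 0}
    \<union> x ` {t. poly (euler K X) t = 0} \<union> x ` E"
  show thesis
  proof (rule that[of S])
    have "lead_coeff f \<noteq> 0" using deg_pos by auto
    then show "finite S"
      unfolding S_def using r(1) finite_E euler_X_nonzero
      by (auto intro!: poly_roots_finite)
  next
    fix x0 assume x0: "x0 \<notin> S"
    show "poly (cpoly (lead_coeff f)) x0 \<noteq> 0" using x0 by (simp add: S_def)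
    show "card (fibre x0) = N" using x0 by (intro card_fibre) (simp add: S_def)
    show "inj_on y (fibre x0)"
    proof (rule inj_onI)
      fix s t assume st: "s \<in> fibre x0" "t \<in> fibre x0" and yst: "y s = y t"
      have s: "s \<noteq> 0" "x s = x0" and t: "t \<noteq> 0" "x t = x0" using st by (auto simp: fibre_def)
      let ?A = "ceval (map_poly pderiv f) x0 (y t)" and ?B = "ceval (pderiv f) x0 (y t)"
      have B: "?B \<noteq> 0" using smooth[of t] t x0 by (simp add: S_def)
      have "?A * poly (euler K X) s + ?B * poly (euler K Y) s = 0"
        and "?A * poly (euler K X) t + ?B * poly (euler K Y) t = 0"
        using tangent_equation[of s] tangent_equation[of t] s t yst by simp_all
      \<comment> \<open>Two velocities normal to the same nonzero gradient are parallel.\<close>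
      then have "?B * (poly (euler K X) s * poly (euler K Y) t - poly (euler K X) t * poly (euler K Y) s) = 0"
        by algebra
      then have "poly (euler K X) s * poly (euler K Y) t = poly (euler K X) t * poly (euler K Y) s"
        using B by simp
      moreover have "x0 \<notin> x ` E" using x0 by (simp add: S_def)
      then have "s \<notin> E" "t \<notin> E" using s t by (metis imageI)+
      ultimately show "s = t" using tangent_separated[of s t] s t yst by simp
    qed
  qed
qed

text \<open>The fibre yields N distinct roots of a polynomial whose degree is at most N, so the
  degree is N and there are no other roots.\<close>

lemma specialize_split:
  assumes "poly (cpoly (lead_coeff f)) x0 \<noteq> 0" "card (fibre x0) = N" "inj_on y (fibre x0)"
  shows "degree f = N"
    "specialize f x0 = smult (poly (cpoly (lead_coeff f)) x0) (\<Prod>t\<in>fibre x0. [:- y t, 1:])"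
proof -
  let ?f = "specialize f x0"
  have deg: "degree ?f = degree f" by (rule degree_specialize) fact
  have f0: "?f \<noteq> 0" using assms(1) by (metis coeff_specialize coeff_0)
  have root: "poly ?f (y t) = 0" if "t \<in> fibre x0" for t
    using vanish_f that by (auto simp: vanish_def fibre_def ceval_def)
  have "N = card (y ` fibre x0)" using assms by (simp add: card_image)
  also have "\<dots> \<le> card {z. poly ?f z = 0}"
    using root by (intro card_mono poly_roots_finite f0) auto
  also have "\<dots> \<le> degree f" using card_poly_roots_bound[OF f0] deg by simp
  finally show N: "degree f = N" using degree_f_le[OF irreducible_f vanish_f] by simp
  let ?P = "\<Prod>t\<in>fibre x0. [:- y t, 1:]"
  have degP: "degree ?P = N" using assms(2) by (simp add: degree_prod_sum_eq)
  moreover have "lead_coeff ?P = 1" by (simp add: lead_coeff_prod)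
  ultimately have coeff_P: "coeff ?P N = 1" by simp
  show "?f = smult (poly (cpoly (lead_coeff f)) x0) ?P" (is "_ = ?g")
  proof (rule poly_eqI_degree_lead_coeff[where n = N and A = "y ` fibre x0"])
    show "poly ?f z = poly ?g z" if z: "z \<in> y ` fibre x0" for z
    proof -
      have "poly ?P z = 0" using z finite_fibre by (auto simp: poly_prod)
      then show ?thesis using z root by auto
    qed
  qed (use N deg degP coeff_P assms in \<open>auto simp: card_image\<close>)
qed

section \<open>Degrees of f and of its coefficients\<close>

lemma degree_f: "degree f = N"
proof -
  obtain S where S: "finite S" "\<And>x0. x0 \<notin> S \<Longrightarrow> poly (cpoly (lead_coeff f)) x0 \<noteq> 0"
    "\<And>x0. x0 \<notin> S \<Longrightarrow> card (fibre x0) = N" "\<And>x0. x0 \<notin> S \<Longrightarrow> inj_on y (fibre x0)"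
    using generic_fibre_injective by blast
  obtain x0 where "x0 \<notin> S" using S(1) ex_new_if_finite infinite_UNIV_char_0 by blast
  then show ?thesis using specialize_split(1) S by blast
qed

text \<open>Up to the leading coefficient and sign, the coefficients of f at \<open>x0\<close> are
  elementary symmetric functions of the values of y over \<open>x0\<close>. These values are bounded
  above and below in terms of |x0|.\<close>

lemma coeff_growth:
  obtains S M where "finite S" "M > 0"
    "\<And>x0 j. x0 \<notin> S \<Longrightarrow> norm (poly (cpoly (coeff f j)) x0)
      \<le> norm (poly (cpoly (lead_coeff f)) x0) * (2 ^ N * (M * (1 + norm x0)) ^ (N - j))"
    "\<And>x0. x0 \<notin> S \<Longrightarrow> norm x0 \<ge> M \<Longrightarrow>
      norm (poly (cpoly (lead_coeff f)) x0) * (norm x0 / M) ^ N \<le> norm (poly (cpoly (coeff f 0)) x0)"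
proof -
  obtain S where S: "finite S" "\<And>x0. x0 \<notin> S \<Longrightarrow> poly (cpoly (lead_coeff f)) x0 \<noteq> 0"
    "\<And>x0. x0 \<notin> S \<Longrightarrow> card (fibre x0) = N" "\<And>x0. x0 \<notin> S \<Longrightarrow> inj_on y (fibre x0)"
    using generic_fibre_injective by blast
  obtain M1 where M1: "M1 > 0" "\<And>t. t \<noteq> 0 \<Longrightarrow> norm (y t) \<le> M1 * (1 + norm (x t))"
    using laurent_comparison[of Y X K] degree_X degree_Y coeff_0_X K(1)
    unfolding x_def y_def by auto
  obtain M2 where M2: "M2 > 0" "\<And>t. t \<noteq> 0 \<Longrightarrow> norm (x t) \<le> M2 * (1 + norm (y t))"
    using laurent_comparison[of X Y K] degree_X degree_Y coeff_0_Y K(1)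
    unfolding x_def y_def by auto
  \<comment> \<open>The factor 2 lets the additive constant in the bound for x be absorbed as soon
    as |x0| is at least M.\<close>
  define M where "M = M1 + 2 * M2"
  have M: "M > 0" "M1 \<le> M" "2 * M2 \<le> M" using M1(1) M2(1) by (auto simp: M_def)
  have f_split: "specialize f x0 = smult (poly (cpoly (lead_coeff f)) x0) (\<Prod>t\<in>fibre x0. [:- y t, 1:])"
    if "x0 \<notin> S" for x0
    using specialize_split(2) S that by blast
  show thesis
  proof (rule that[of S M])
    fix x0 j assume x0: "x0 \<notin> S"
    have y_le: "norm (y t) \<le> M * (1 + norm x0)" if "t \<in> fibre x0" for t
    proof -
      have "norm (y t) \<le> M1 * (1 + norm x0)" using M1(2)[of t] that by (auto simp: fibre_def)
      also have "\<dots> \<le> M * (1 + norm x0)" using M by (intro mult_right_mono) auto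
      finally show ?thesis .
    qed
    have "norm (coeff (\<Prod>t\<in>fibre x0. [:- y t, 1:]) j) \<le> 2 ^ N * (M * (1 + norm x0)) ^ (N - j)"
      using norm_coeff_prod_linear_le[of "fibre x0" y "M * (1 + norm x0)" j] finite_fibre y_le M S(3)[OF x0] by simp
    moreover have "poly (cpoly (coeff f j)) x0
        = poly (cpoly (lead_coeff f)) x0 * coeff (\<Prod>t\<in>fibre x0. [:- y t, 1:]) j"
      using arg_cong[OF f_split[OF x0], of "\<lambda>P. coeff P j"] by simp
    ultimately show "norm (poly (cpoly (coeff f j)) x0)
      \<le> norm (poly (cpoly (lead_coeff f)) x0) * (2 ^ N * (M * (1 + norm x0)) ^ (N - j))"
      by (simp add: norm_mult mult_left_mono)
  next
    fix x0 assume x0: "x0 \<notin> S" and large: "norm x0 \<ge> M"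
    have y_ge: "norm x0 / M \<le> norm (y t)" if "t \<in> fibre x0" for t
    proof -
      have "norm x0 \<le> M2 * (1 + norm (y t))" using M2(2)[of t] that by (auto simp: fibre_def)
      then have "2 * norm x0 \<le> M + M * norm (y t)"
        using M mult_right_mono[OF M(3), of "1 + norm (y t)"] by (simp add: algebra_simps)
      then have "norm x0 \<le> M * norm (y t)" using large by simp
      then show ?thesis using M by (simp add: field_simps)
    qed
    have "poly (cpoly (coeff f 0)) x0 = poly (specialize f x0) 0"
      by (simp add: poly_0_coeff_0)
    also have "\<dots> = poly (cpoly (lead_coeff f)) x0 * (\<Prod>t\<in>fibre x0. - y t)"
      by (simp add: f_split[OF x0] poly_prod)
    finally have "norm (poly (cpoly (coeff f 0)) x0)
        = norm (poly (cpoly (lead_coeff f)) x0) * (\<Prod>t\<in>fibre x0. norm (y t))"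
      by (simp add: norm_mult flip: prod_norm)
    moreover have "(\<Prod>t\<in>fibre x0. norm x0 / M) \<le> (\<Prod>t\<in>fibre x0. norm (y t))"
      using y_ge M by (intro prod_mono) auto
    ultimately show "norm (poly (cpoly (lead_coeff f)) x0) * (norm x0 / M) ^ N
        \<le> norm (poly (cpoly (coeff f 0)) x0)"
      using S(3)[OF x0] by (simp add: mult_left_mono)
  qed (use S M in auto)
qed

text \<open>At a zero of the leading coefficient, every coefficient vanishes by the growth estimate,
  so these zeros would give a common factor of the coefficients.\<close>

lemma degree_lead_coeff_f: "degree (lead_coeff f) = 0"
proof (rule ccontr)
  assume "degree (lead_coeff f) \<noteq> 0"
  then have "\<not> constant (poly (cpoly (lead_coeff f)))" by (simp add: constant_degree)
  then obtain a where a: "poly (cpoly (lead_coeff f)) a = 0"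
    using fundamental_theorem_of_algebra by blast
  obtain S M where S: "finite S" and bound: "\<And>x0 j. x0 \<notin> S \<Longrightarrow> norm (poly (cpoly (coeff f j)) x0)
      \<le> norm (poly (cpoly (lead_coeff f)) x0) * (2 ^ N * (M * (1 + norm x0)) ^ (N - j))"
    using coeff_growth by metis
  have zero: "poly (cpoly (coeff f j)) a = 0" for j
  proof -
    have "((\<lambda>x0. norm (poly (cpoly (lead_coeff f)) x0) * (2 ^ N * (M * (1 + norm x0)) ^ (N - j)))
        \<longlongrightarrow> norm (poly (cpoly (lead_coeff f)) a) * (2 ^ N * (M * (1 + norm a)) ^ (N - j))) (at a)"
      by (intro tendsto_intros)
    moreover have "((\<lambda>x0. norm (poly (cpoly (coeff f j)) x0)) \<longlongrightarrow> norm (poly (cpoly (coeff f j)) a)) (at a)"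
      by (intro tendsto_intros)
    moreover have "\<forall>\<^sub>F x0 in at a. norm (poly (cpoly (coeff f j)) x0)
        \<le> norm (poly (cpoly (lead_coeff f)) x0) * (2 ^ N * (M * (1 + norm x0)) ^ (N - j))"
      using eventually_at_not_in_finite[OF S] by eventually_elim (rule bound)
    ultimately have "norm (poly (cpoly (coeff f j)) a)
        \<le> norm (poly (cpoly (lead_coeff f)) a) * (2 ^ N * (M * (1 + norm a)) ^ (N - j))"
      by (intro tendsto_le[of "at a"]) auto
    then show ?thesis using a by simp
  qed
  define d where "d = content f"
  have f_eq: "f = [:d:] * primitive_part f"
    unfolding d_def by (simp add: content_times_primitive_part)
  have "is_unit [:d:] \<or> is_unit (primitive_part f)"
    using irreducible_f f_eq by (rule irreducibleD)
  then have "is_unit d"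
  proof
    assume "is_unit (primitive_part f)"
    then have "degree (primitive_part f) = 0" by (metis is_unit_polyE degree_pCons_0)
    then show ?thesis using degree_f_pos[OF irreducible_f vanish_f] by simp
  qed (simp add: is_unit_const_poly_iff)
  moreover have "poly (cpoly d) a = 0"
  proof -
    \<comment> \<open>By Bezout the gcd of real polynomials is a combination of them, so a common
      complex root is also a root of the content.\<close>
    have comb: "poly (cpoly (Gcd_fin A)) a = 0" if "finite A" "\<And>c. c \<in> A \<Longrightarrow> poly (cpoly c) a = 0" for A
      using that
    proof (induction A rule: finite_induct)
      case (insert c A)
      have "gcd c (Gcd_fin A) = fst (bezout_coefficients c (Gcd_fin A)) * c
          + snd (bezout_coefficients c (Gcd_fin A)) * Gcd_fin A"
        by (simp add: bezout_coefficients_fst_snd)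
      then show ?case using insert by (simp add: cpoly_add cpoly_mult)
    qed auto
    have "d = Gcd_fin (set (coeffs f))" by (simp add: d_def content_def)
    moreover have "poly (cpoly c) a = 0" if "c \<in> set (coeffs f)" for c
      using that zero range_coeff[of f] by (metis insertCI rangeE)
    ultimately show ?thesis using comb by simp
  qed
  ultimately show False
    by (auto simp: is_unit_poly_iff)
qed

text \<open>With a constant leading coefficient, the upper growth bound is itself polynomial in |x0|
  of degree N - j.\<close>

lemma degree_coeff_f_le: "degree (coeff f j) \<le> N - j"
proof -
  obtain S M where S: "finite S" "M > 0" and bound: "\<And>x0 j. x0 \<notin> S \<Longrightarrow> norm (poly (cpoly (coeff f j)) x0)
      \<le> norm (poly (cpoly (lead_coeff f)) x0) * (2 ^ N * (M * (1 + norm x0)) ^ (N - j))"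
    using coeff_growth by metis
  obtain l where l: "lead_coeff f = [:l:]" using degree_lead_coeff_f by (metis degree_eq_zeroE)
  have "\<forall>\<^sub>F x0 in at_infinity. norm (poly (cpoly (coeff f j)) x0)
      \<le> (\<bar>l\<bar> * 2 ^ N * M ^ (N - j)) * (1 + norm x0) ^ (N - j)"
    using eventually_at_infinity_not_in_finite[OF S(1)]
  proof eventually_elim
    case (elim x0)
    then show ?case using bound[of x0 j] by (simp add: l power_mult_distrib mult_ac)
  qed
  from degree_le_of_growth[OF this] show ?thesis by simp
qed

text \<open>The constant coefficient is, up to sign and a nonzero constant, the product of N values
  of y, each of which grows at least like |x0|.\<close>

lemma degree_coeff_0_f: "degree (coeff f 0) = N"
proof -
  obtain S M where S: "finite S" "M > 0" and bound: "\<And>x0. x0 \<notin> S \<Longrightarrow> norm x0 \<ge> M \<Longrightarrow>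
      norm (poly (cpoly (lead_coeff f)) x0) * (norm x0 / M) ^ N \<le> norm (poly (cpoly (coeff f 0)) x0)"
    using coeff_growth by metis
  obtain l where l: "lead_coeff f = [:l:]" using degree_lead_coeff_f by (metis degree_eq_zeroE)
  have l0: "l \<noteq> 0" using l degree_f_pos[OF irreducible_f vanish_f] by auto
  have "\<forall>\<^sub>F x0 :: complex in at_infinity. norm x0 \<ge> M"
    unfolding eventually_at_infinity by blast
  with eventually_at_infinity_not_in_finite[OF S(1)]
  have "\<forall>\<^sub>F x0 in at_infinity. \<bar>l\<bar> / M ^ N * norm x0 ^ N \<le> norm (poly (cpoly (coeff f 0)) x0)"
  proof eventually_elim
    case (elim x0)
    then show ?case using bound[of x0] by (simp add: l power_divide)
  qed
  from degree_ge_of_growth[OF _ this] have "N \<le> degree (coeff f 0)" using l0 S by simp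
  then show ?thesis using degree_coeff_f_le[of 0] by simp
qed

lemma defining_degrees: "total_degree f = N" "deg_x f = N" "deg_y f = N"
proof -
  have coeff_0: "coeff f 0 \<noteq> 0" using degree_coeff_0_f K by auto
  show "deg_y f = N" by (simp add: deg_y_def degree_f)
  have fin: "finite {degree (coeff f i) | i. i \<le> degree f}"
    "finite {degree (coeff f i) + i | i. i \<le> degree f \<and> coeff f i \<noteq> 0}"
    by simp_all
  show "deg_x f = N"
    unfolding deg_x_def
  proof (rule Max_eqI)
    show "N \<in> insert 0 {degree (coeff f i) | i. i \<le> degree f}"
      using degree_coeff_0_f by force
    fix k assume "k \<in> insert 0 {degree (coeff f i) | i. i \<le> degree f}"
    then show "k \<le> N" using degree_coeff_f_le by (force intro: order_trans)
  qed (use fin in simp)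
  show "total_degree f = N"
    unfolding total_degree_def
  proof (rule Max_eqI)
    show "N \<in> insert 0 {degree (coeff f i) + i | i. i \<le> degree f \<and> coeff f i \<noteq> 0}"
      using degree_coeff_0_f coeff_0 by force
    fix k assume "k \<in> insert 0 {degree (coeff f i) + i | i. i \<le> degree f \<and> coeff f i \<noteq> 0}"
    then consider "k = 0" | i where "i \<le> N" "k = degree (coeff f i) + i"
      using degree_f by auto
    then show "k \<le> N"
    proof cases
      case 2
      then show ?thesis using degree_coeff_f_le[of i] by simp
    qed simp
  qed (use fin in simp)
qed

end

text \<open>As the vanishing ideal is generated by an irreducible polynomial, the zeros of this
  generator form the Zariski closure. Conversely, a defining polynomial vanishes on C because C lies
  in its closure.\<close>

theorem defining_poly_degrees:
  fixes C
  assumes C: "C = (\<lambda>\<theta>. (Re (x (cis \<theta>)), Re (y (cis \<theta>)))) ` {-pi..pi}"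
  shows "\<exists>f. defining_poly C f"
    and "defining_poly C f \<Longrightarrow> total_degree f = N \<and> deg_x f = N \<and> deg_y f = N"
proof -
  have vanish: "vanish g \<longleftrightarrow> (\<forall>(u, v)\<in>C. eval2 g u v = 0)" for g
    by (auto simp: vanish_iff C)
  have closure: "zariski_closure C = {(u, v). \<forall>g. vanish g \<longrightarrow> eval2 g u v = 0}"
    by (simp add: zariski_closure_def vanish)
  obtain f0 where f0: "irreducible f0" "vanish f0" using irreducible_vanishing_exists by blast
  have eval2_mult: "eval2 (g * h) u v = eval2 g u v * eval2 h u v" for g h u v
    using ceval_mult[of g h "of_real u" "of_real v"]
    by (simp add: ceval_of_real flip: of_real_mult)
  have "{(u, v). eval2 f0 u v = 0} = zariski_closure C"
    unfolding closure using f0 by (auto simp: vanish_iff_dvd[OF f0] eval2_mult)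
  then show "\<exists>f. defining_poly C f" using f0 by (auto simp: defining_poly_def)
  assume f: "defining_poly C f"
  then have "vanish f"
    unfolding vanish defining_poly_def zariski_closure_def by blast
  then show "total_degree f = N \<and> deg_x f = N \<and> deg_y f = N"
    using defining_degrees f by (simp add: defining_poly_def)
qed

end

subsection \<open>Curves given by a support function\<close>

text \<open>U is the support function p as a polynomial in \<open>t = cis \<theta>\<close>, multiplied by \<open>t ^ D\<close>.\<close>

locale support_function =
  fixes U :: "complex poly" and D :: nat and p p' :: "real \<Rightarrow> real"
  assumes D: "D \<ge> 2" and degree_U: "degree U = 2 * D"
    and coeff_U: "coeff U 0 \<noteq> 0" "coeff U D \<noteq> 0"
    and poly_U_cis: "\<And>\<theta>. poly U (cis \<theta>) = of_real (p \<theta>) * cis \<theta> ^ D"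
    and p': "\<And>\<theta>. (p has_real_derivative p' \<theta>) (at \<theta>)"
begin

text \<open>The polynomials \<open>Z = t ^ (D + 1) (x + \<i> y)\<close> and \<open>W = t ^ (D + 1) (x - \<i> y)\<close>, where
  \<open>x + \<i> y = (p + \<i> p') t\<close>.\<close>

definition Z where "Z = monom 1 2 * (smult (of_nat (Suc D)) U - pCons 0 (pderiv U))"
definition W where "W = smult (1 - of_nat D) U + pCons 0 (pderiv U)"
definition X where "X = smult (1 / 2) (Z + W)"
definition Y where "Y = smult (- \<i> / 2) (Z - W)"

lemma coeff_pCons_pderiv: "coeff (pCons 0 (pderiv P)) j = of_nat j * coeff P j"
  by (cases j) (auto simp: coeff_pderiv)

lemma coeff_Z: "coeff Z j = (if j < 2 then 0 else (of_nat (Suc D) - of_nat (j - 2)) * coeff U (j - 2))"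
  unfolding Z_def coeff_monom_mult by (auto simp: coeff_pCons_pderiv algebra_simps)

lemma coeff_W: "coeff W j = (1 - of_nat D + of_nat j) * coeff U j"
  by (simp add: W_def coeff_pCons_pderiv distrib_right)

lemma coeff_U_high: "coeff U j = 0" if "2 * D < j"
  using that degree_U by (intro coeff_eq_0) simp

lemma coeff_U_top: "coeff U (2 * D) \<noteq> 0"
  using degree_U coeff_U by (metis coeff_0 leading_coeff_neq_0)

lemma one_minus_D: "(1 :: complex) - of_nat D \<noteq> 0"
proof -
  have "of_nat D \<noteq> (of_nat 1 :: complex)" using D by (subst of_nat_eq_iff) simp
  then show ?thesis by simp
qed

text \<open>The top coefficient comes from Z alone and the constant one from W alone. Both carry the
  factor 1 - D, nonzero because D is at least 2.\<close>

lemma degree_combination: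
  assumes "\<alpha> \<noteq> 0" "\<beta> \<noteq> 0"
  shows "degree (smult \<alpha> Z + smult \<beta> W) = 2 * D + 2" "coeff (smult \<alpha> Z + smult \<beta> W) 0 \<noteq> 0"
proof -
  have "coeff Z (2 * D + 2) = (1 - of_nat D) * coeff U (2 * D)"
    by (simp add: coeff_Z algebra_simps)
  then have "coeff (smult \<alpha> Z + smult \<beta> W) (2 * D + 2) \<noteq> 0"
    using assms coeff_U_top one_minus_D by (simp add: coeff_W coeff_U_high)
  then have "2 * D + 2 \<le> degree (smult \<alpha> Z + smult \<beta> W)" by (rule le_degree)
  moreover have "degree (smult \<alpha> Z + smult \<beta> W) \<le> 2 * D + 2"
    by (rule degree_le) (auto simp: coeff_Z coeff_W coeff_U_high)
  ultimately show "degree (smult \<alpha> Z + smult \<beta> W) = 2 * D + 2" by simp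
  show "coeff (smult \<alpha> Z + smult \<beta> W) 0 \<noteq> 0"
    using assms coeff_U one_minus_D by (simp add: coeff_Z coeff_W)
qed

lemma X_eq: "X = smult (1 / 2) Z + smult (1 / 2) W"
  and Y_eq: "Y = smult (- \<i> / 2) Z + smult (\<i> / 2) W"
  by (simp_all add: X_def Y_def smult_add_right smult_diff_right)

text \<open>Differentiates both sides of \<open>poly_U_cis\<close> with respect to \<theta> and
  compares the results.\<close>

lemma poly_pderiv_U_cis:
  "cis \<theta> * poly (pderiv U) (cis \<theta>) = (of_nat D * of_real (p \<theta>) - \<i> * of_real (p' \<theta>)) * cis \<theta> ^ D"
proof -
  have cis': "(cis has_vector_derivative \<i> * cis \<theta>) (at \<theta>)"
    unfolding has_vector_derivative_def by (auto intro!: derivative_eq_intros)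
  have "((\<lambda>\<theta>. poly U (cis \<theta>)) has_vector_derivative \<i> * cis \<theta> * poly (pderiv U) (cis \<theta>)) (at \<theta>)"
    using field_vector_diff_chain_at[OF cis' poly_DERIV] by (simp add: o_def)
  moreover have "((\<lambda>\<theta>. of_real (p \<theta>) * cis \<theta> ^ D) has_vector_derivative
      of_real (p \<theta>) * (\<i> * cis \<theta> * (of_nat D * cis \<theta> ^ (D - 1))) + of_real (p' \<theta>) * cis \<theta> ^ D) (at \<theta>)"
  proof (rule has_vector_derivative_mult)
    show "((\<lambda>\<theta>. of_real (p \<theta>)) has_vector_derivative complex_of_real (p' \<theta>)) (at \<theta>)"
      by (intro has_vector_derivative_of_real p')
    have "((\<lambda>z. z ^ D) has_field_derivative of_nat D * cis \<theta> ^ (D - 1)) (at (cis \<theta>))"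
      by (auto intro!: derivative_eq_intros)
    from field_vector_diff_chain_at[OF cis' this]
    show "((\<lambda>\<theta>. cis \<theta> ^ D) has_vector_derivative \<i> * cis \<theta> * (of_nat D * cis \<theta> ^ (D - 1))) (at \<theta>)"
      by (simp add: o_def)
  qed
  ultimately have "\<i> * cis \<theta> * poly (pderiv U) (cis \<theta>)
      = of_real (p \<theta>) * (\<i> * cis \<theta> * (of_nat D * cis \<theta> ^ (D - 1))) + of_real (p' \<theta>) * cis \<theta> ^ D"
    unfolding poly_U_cis by (rule vector_derivative_unique_at)
  also have "\<dots> = \<i> * ((of_nat D * of_real (p \<theta>) - \<i> * of_real (p' \<theta>)) * cis \<theta> ^ D)"
    using D by (cases D) (auto simp: algebra_simps)
  finally show ?thesis by simp
qed

lemma poly_Z_cis: "poly Z (cis \<theta>) / cis \<theta> ^ Suc D = (of_real (p \<theta>) + \<i> * of_real (p' \<theta>)) * cis \<theta>"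
proof -
  have "poly Z (cis \<theta>)
      = cis \<theta> ^ 2 * (of_nat (Suc D) * poly U (cis \<theta>) - cis \<theta> * poly (pderiv U) (cis \<theta>))"
    by (simp add: Z_def poly_monom)
  also have "\<dots> = (of_real (p \<theta>) + \<i> * of_real (p' \<theta>)) * cis \<theta> * cis \<theta> ^ Suc D"
    unfolding poly_pderiv_U_cis poly_U_cis by (simp add: algebra_simps power2_eq_square)
  finally show ?thesis by simp
qed

lemma poly_W_cis: "poly W (cis \<theta>) / cis \<theta> ^ Suc D = (of_real (p \<theta>) - \<i> * of_real (p' \<theta>)) * cis (- \<theta>)"
proof -
  have "poly W (cis \<theta>) = (1 - of_nat D) * poly U (cis \<theta>) + cis \<theta> * poly (pderiv U) (cis \<theta>)"
    by (simp add: W_def)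
  also have "\<dots> = (of_real (p \<theta>) - \<i> * of_real (p' \<theta>)) * cis \<theta> ^ D"
    unfolding poly_pderiv_U_cis poly_U_cis by (simp add: algebra_simps)
  finally have "poly W (cis \<theta>) / cis \<theta> ^ Suc D = (of_real (p \<theta>) - \<i> * of_real (p' \<theta>)) / cis \<theta>"
    by simp
  then show ?thesis by (simp only: divide_inverse cis_inverse)
qed

lemma poly_X_cis:
  "poly X (cis \<theta>) / cis \<theta> ^ Suc D = of_real (p \<theta> * cos \<theta> - p' \<theta> * sin \<theta>)" (is ?x)
  and poly_Y_cis:
  "poly Y (cis \<theta>) / cis \<theta> ^ Suc D = of_real (p \<theta> * sin \<theta> + p' \<theta> * cos \<theta>)" (is ?y)
proof -
  have "poly X (cis \<theta>) / cis \<theta> ^ Suc D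
      = 1 / 2 * (poly Z (cis \<theta>) / cis \<theta> ^ Suc D + poly W (cis \<theta>) / cis \<theta> ^ Suc D)"
    by (simp add: X_def field_simps)
  also have "\<dots> = of_real (p \<theta> * cos \<theta> - p' \<theta> * sin \<theta>)"
    unfolding poly_Z_cis poly_W_cis by (simp add: complex_eq_iff)
  finally show ?x .
  have "poly Y (cis \<theta>) / cis \<theta> ^ Suc D
      = - \<i> / 2 * (poly Z (cis \<theta>) / cis \<theta> ^ Suc D - poly W (cis \<theta>) / cis \<theta> ^ Suc D)"
    by (simp add: Y_def field_simps)
  also have "\<dots> = of_real (p \<theta> * sin \<theta> + p' \<theta> * cos \<theta>)"
    unfolding poly_Z_cis poly_W_cis by (simp add: complex_eq_iff)
  finally show ?y .
qed

sublocale laurent_curve X Y "Suc D" "2 * D + 2"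
proof
  show "degree X = 2 * D + 2" "coeff X 0 \<noteq> 0"
    unfolding X_eq by (rule degree_combination; simp)+
  show "degree Y = 2 * D + 2" "coeff Y 0 \<noteq> 0"
    unfolding Y_eq by (rule degree_combination; simp)+
  show "poly X (cis \<theta>) / cis \<theta> ^ Suc D \<in> \<real>" "poly Y (cis \<theta>) / cis \<theta> ^ Suc D \<in> \<real>" for \<theta>
    unfolding poly_X_cis poly_Y_cis by (rule Reals_of_real)+
qed (use D in auto)

text \<open>The Gauss map: the normal direction at the parameter t is t itself.\<close>

lemma euler_Z: "poly (euler (Suc D) Z) t = - t\<^sup>2 * poly (euler (Suc D) W) t"
proof -
  have "euler (Suc D) Z = - (monom 1 2 * euler (Suc D) W)"
    by (rule poly_eqI) (auto simp: coeff_euler coeff_monom_mult coeff_Z coeff_W algebra_simps)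
  then show ?thesis by (simp add: poly_monom)
qed

text \<open>The numerator of the difference of x + iy at t and at -t; the sign comes from
  \<open>(- t) ^ Suc D\<close>.\<close>

definition odd_part where "odd_part = Z + smult ((-1) ^ D) (pcompose Z [:0, -1:])"

text \<open>The mean value of the support function contributes a linear term in t to x + iy. It sits
  at exponent D + 2 of Z and is doubled in the odd part.\<close>

lemma odd_part_nonzero: "odd_part \<noteq> 0"
proof -
  have "(-1) ^ D * (-1) ^ (D + 2) = (1 :: complex)" by (cases "even D") auto
  then have "coeff odd_part (D + 2) = 2 * coeff U D"
    by (simp add: odd_part_def coeff_pcompose_linear coeff_Z mult.assoc[symmetric])
  then show ?thesis using coeff_U(2) by auto
qed

lemma poly_odd_part: "poly odd_part s / s ^ Suc D = poly Z s / s ^ Suc D - poly Z (- s) / (- s) ^ Suc D"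
proof -
  have "(- s) ^ Suc D = (-1) ^ Suc D * s ^ Suc D" by (rule power_minus)
  then show ?thesis by (cases "even D") (auto simp: odd_part_def poly_pcompose add_divide_distrib diff_divide_distrib)
qed

sublocale tangent_separated_laurent_curve X Y "Suc D" "2 * D + 2"
  "{t. poly (euler (Suc D) X) t = 0} \<union> {t. poly odd_part t = 0}"
proof
  show "finite ({t. poly (euler (Suc D) X) t = 0} \<union> {t. poly odd_part t = 0})"
    using odd_part_nonzero euler_X_nonzero by (simp add: poly_roots_finite)
next
  fix s t :: complex
  assume s0: "s \<noteq> 0" and t0: "t \<noteq> 0"
    and s: "s \<notin> {t. poly (euler (Suc D) X) t = 0} \<union> {t. poly odd_part t = 0}"
    and t: "t \<notin> {t. poly (euler (Suc D) X) t = 0} \<union> {t. poly odd_part t = 0}"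
    and eq: "x s = x t" "y s = y t"
    and tangent: "poly (euler (Suc D) X) s * poly (euler (Suc D) Y) t
      = poly (euler (Suc D) X) t * poly (euler (Suc D) Y) s"
  \<comment> \<open>Up to the scalar \<open>?w t / 2\<close>, the velocity at t is (1 - t^2, i(1 +
    t^2)). Parallel velocities therefore force s^2 = t^2.\<close>
  let ?w = "\<lambda>t. poly (euler (Suc D) W) t"
  have eX: "poly (euler (Suc D) X) t = (1 - t\<^sup>2) * (?w t / 2)" for t
    unfolding X_eq euler_combination by (simp add: euler_Z field_simps)
  have eY: "poly (euler (Suc D) Y) t = (1 + t\<^sup>2) * (\<i> * ?w t / 2)" for t
    unfolding Y_eq euler_combination by (simp add: euler_Z field_simps)
  have w: "?w s \<noteq> 0" "?w t \<noteq> 0" using s t by (auto simp: eX)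
  have "(1 - s\<^sup>2) * (1 + t\<^sup>2) * (\<i> / 4 * ?w s * ?w t) = (1 - t\<^sup>2) * (1 + s\<^sup>2) * (\<i> / 4 * ?w s * ?w t)"
    using tangent unfolding eX eY by (simp add: mult_ac)
  then have "(1 - s\<^sup>2) * (1 + t\<^sup>2) = (1 - t\<^sup>2) * (1 + s\<^sup>2)" using w by simp
  then have "s\<^sup>2 = t\<^sup>2" by algebra
  then consider "s = t" | "t = - s" by (metis power2_eq_iff minus_minus)
  then show "s = t"
  proof cases
    case 2
    \<comment> \<open>Equal images at s and -s would make s a zero of the odd part, which the
      exceptional set excludes.\<close>
    have Z: "poly Z t / t ^ Suc D = x t + \<i> * y t" for t
    proof -
      have "Z = X + smult \<i> Y" by (simp add: poly_eq_iff X_def Y_def algebra_simps)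
      then show ?thesis by (simp add: x_def y_def add_divide_distrib)
    qed
    have "poly odd_part s / s ^ Suc D = 0"
      unfolding poly_odd_part 2[symmetric] Z using eq by simp
    then show ?thesis using s s0 by simp
  qed
qed

lemma support_curve_degrees:
  assumes C: "C = (\<lambda>\<theta>. (p \<theta> * cos \<theta> - p' \<theta> * sin \<theta>, p \<theta> * sin \<theta> + p' \<theta> * cos \<theta>)) ` {-pi..pi}"
  shows "(\<exists>f. defining_poly C f) \<and> (\<forall>f. defining_poly C f \<longrightarrow>
    total_degree f = 2 * D + 2 \<and> deg_x f = 2 * D + 2 \<and> deg_y f = 2 * D + 2)"
proof -
  have "C = (\<lambda>\<theta>. (Re (x (cis \<theta>)), Re (y (cis \<theta>)))) ` {-pi..pi}"
    unfolding C x_def y_def poly_X_cis poly_Y_cis Re_complex_of_real ..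
  from defining_poly_degrees[OF this] show ?thesis by blast
qed

end

subsection \<open>Trigonometric polynomials\<close>

text \<open>The harmonic of frequency l as a polynomial in \<open>cis \<theta>\<close>, multiplied
  by the D-th power. The frequency is an integer because kn - 1 is negative for k = 0.\<close>

definition harmonic :: "nat \<Rightarrow> real \<Rightarrow> real \<Rightarrow> int \<Rightarrow> complex poly" where
  "harmonic D \<alpha> \<beta> l = monom (Complex \<alpha> (- \<beta>) / 2) (nat (int D + l))
    + monom (Complex \<alpha> \<beta> / 2) (nat (int D - l))"

lemma poly_harmonic_cis:
  assumes "\<bar>l\<bar> \<le> int D"
  shows "poly (harmonic D \<alpha> \<beta> l) (cis \<theta>)
    = of_real (\<alpha> * cos (real_of_int l * \<theta>) + \<beta> * sin (real_of_int l * \<theta>)) * cis \<theta> ^ D"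
proof -
  have pow: "cis \<theta> ^ nat (int D + j) = cis (real_of_int j * \<theta>) * cis \<theta> ^ D" if "\<bar>j\<bar> \<le> int D" for j
  proof -
    have "real (nat (int D + j)) = real D + real_of_int j" using that by simp
    then show ?thesis unfolding Complex.DeMoivre cis_mult by (simp only: distrib_right add.commute)
  qed
  have "poly (harmonic D \<alpha> \<beta> l) (cis \<theta>) = (Complex \<alpha> (- \<beta>) / 2 * cis (real_of_int l * \<theta>)
      + Complex \<alpha> \<beta> / 2 * cis (- (real_of_int l * \<theta>))) * cis \<theta> ^ D"
    using pow[of l] pow[of "- l"] assms by (simp add: harmonic_def poly_monom algebra_simps)
  also have "Complex \<alpha> (- \<beta>) / 2 * cis (real_of_int l * \<theta>)
      + Complex \<alpha> \<beta> / 2 * cis (- (real_of_int l * \<theta>))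
      = of_real (\<alpha> * cos (real_of_int l * \<theta>) + \<beta> * sin (real_of_int l * \<theta>))"
    by (simp add: complex_eq_iff field_simps)
  finally show ?thesis .
qed

lemma degree_harmonic_le: "degree (harmonic D \<alpha> \<beta> l) \<le> 2 * D" if "\<bar>l\<bar> \<le> int D"
  unfolding harmonic_def
  by (intro degree_add_le order_trans[OF degree_monom_le]) (use that in auto)

text \<open>Frequencies strictly between -D and D do not reach the extreme exponents 0 and 2D, so
  the end coefficients of the sum come from the top harmonic.\<close>

lemma coeff_harmonic_inner:
  "coeff (harmonic D \<alpha> \<beta> l) 0 = 0" "coeff (harmonic D \<alpha> \<beta> l) (2 * D) = 0" if "\<bar>l\<bar> < int D"
  using that by (auto simp: harmonic_def)

lemma coeff_harmonic_middle: "coeff (harmonic D \<alpha> \<beta> l) D = 0" if "l \<noteq> 0" "\<bar>l\<bar> \<le> int D"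
  using that by (auto simp: harmonic_def)

lemma coeff_harmonic_outer:
  "coeff (harmonic D \<alpha> \<beta> (int D)) 0 = Complex \<alpha> \<beta> / 2"
  "coeff (harmonic D \<alpha> \<beta> (int D)) (2 * D) = Complex \<alpha> (- \<beta>) / 2" if "D > 0"
  using that by (auto simp: harmonic_def nat_add_distrib)

theorem theorem2p8:
  fixes n m :: nat and \<rho> :: real and a b :: "int \<Rightarrow> real"
    and p :: "real \<Rightarrow> real" and C :: "(real \<times> real) set"
  assumes "n \<ge> 3" and "\<rho> > 0"
    and p_def: "\<And>\<theta>. p \<theta> = \<rho> + (\<Sum>k=0..m.
              a (int k * int n + 1) * cos (real_of_int (int k * int n + 1) * \<theta>)
            + b (int k * int n + 1) * sin (real_of_int (int k * int n + 1) * \<theta>)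
            + a (int k * int n - 1) * cos (real_of_int (int k * int n - 1) * \<theta>)
            + b (int k * int n - 1) * sin (real_of_int (int k * int n - 1) * \<theta>))"
    and "\<And>\<theta>. p \<theta> + deriv (deriv p) \<theta> \<ge> 0"
    and C_def: "C = (\<lambda>\<theta>. (p \<theta> * cos \<theta> - deriv p \<theta> * sin \<theta>,
                            p \<theta> * sin \<theta> + deriv p \<theta> * cos \<theta>)) ` {-pi..pi}"
    and "\<not> is_circle C"
    and "a (int n * int m + 1) \<noteq> 0 \<or> b (int n * int m + 1) \<noteq> 0"
  shows "(\<exists>f. defining_poly C f) \<and>
         (\<forall>f. defining_poly C f \<longrightarrow>
            total_degree f = 2 * n * m + 4 \<and> deg_x f = 2 * n * m + 4 \<and> deg_y f = 2 * n * m + 4)"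
proof -
  define q where "q = (\<lambda>l \<theta>. a l * cos (real_of_int l * \<theta>) + b l * sin (real_of_int l * \<theta>))"
  define q' where "q' = (\<lambda>l \<theta>. real_of_int l * (b l * cos (real_of_int l * \<theta>) - a l * sin (real_of_int l * \<theta>)))"
  define l1 where "l1 = (\<lambda>k. int k * int n + 1)"
  define l2 where "l2 = (\<lambda>k. int k * int n - 1)"
  have p_eq: "p = (\<lambda>\<theta>. \<rho> + (\<Sum>k=0..m. q (l1 k) \<theta> + q (l2 k) \<theta>))"
    by (rule ext) (simp add: p_def q_def l1_def l2_def add.assoc)
  have q: "(q l has_real_derivative q' l \<theta>) (at \<theta>)" for l \<theta>
    unfolding q_def q'_def by (auto intro!: derivative_eq_intros simp: algebra_simps)
  have dp: "(p has_real_derivative (\<Sum>k=0..m. q' (l1 k) \<theta> + q' (l2 k) \<theta>)) (at \<theta>)" for \<theta>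
    unfolding p_eq using q by (auto intro!: derivative_eq_intros)
  then have deriv_p: "deriv p \<theta> = (\<Sum>k=0..m. q' (l1 k) \<theta> + q' (l2 k) \<theta>)" for \<theta>
    by (rule DERIV_imp_deriv)
  \<comment> \<open>For m = 0 only the frequencies 1 and -1 occur, and the curve is the circle of
    radius \<rho> around (A, B), which is excluded.\<close>
  have m: "m > 0"
  proof (rule ccontr)
    assume "\<not> m > 0"
    then have m0: "m = 0" by simp
    define A B where "A = a 1 + a (- 1)" and "B = b 1 - b (- 1)"
    have pA: "p \<theta> = \<rho> + A * cos \<theta> + B * sin \<theta>" "deriv p \<theta> = B * cos \<theta> - A * sin \<theta>" for \<theta>
      unfolding deriv_p by (simp_all add: p_eq m0 q_def q'_def l1_def l2_def A_def B_def algebra_simps)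
    have trig: "cos \<theta> * cos \<theta> = 1 - sin \<theta> * sin \<theta>" for \<theta> :: real
      using sin_cos_squared_add[of \<theta>] by (simp add: power2_eq_square)
    have "p \<theta> * cos \<theta> - deriv p \<theta> * sin \<theta> = A + \<rho> * cos \<theta>"
      "p \<theta> * sin \<theta> + deriv p \<theta> * cos \<theta> = B + \<rho> * sin \<theta>" for \<theta>
      unfolding pA by (simp_all add: algebra_simps trig)
    then have C: "C = (\<lambda>\<theta>. (A + \<rho> * cos \<theta>, B + \<rho> * sin \<theta>)) ` {-pi..pi}"
      unfolding C_def by simp
    have "C = {(x, y). (x - A)\<^sup>2 + (y - B)\<^sup>2 = \<rho>\<^sup>2}"
    proof (intro equalityI subsetI)
      fix P assume "P \<in> C"
      then show "P \<in> {(x, y). (x - A)\<^sup>2 + (y - B)\<^sup>2 = \<rho>\<^sup>2}"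
        by (auto simp: C power_mult_distrib simp flip: distrib_left)
    next
      fix P assume "P \<in> {(x, y). (x - A)\<^sup>2 + (y - B)\<^sup>2 = \<rho>\<^sup>2}"
      then obtain x y where P: "P = (x, y)" "(x - A)\<^sup>2 + (y - B)\<^sup>2 = \<rho>\<^sup>2" by auto
      \<comment> \<open>The normalised point lies on the unit circle, and its argument is the
        required parameter.\<close>
      define z where "z = Complex ((x - A) / \<rho>) ((y - B) / \<rho>)"
      have "norm z = 1"
        using P(2) assms(2) by (simp add: z_def cmod_def power_divide flip: add_divide_distrib)
      then have "cis (Arg z) = z" using cis_Arg[of z] by (cases "z = 0") (auto simp: sgn_eq)
      then have "cos (Arg z) = (x - A) / \<rho>" "sin (Arg z) = (y - B) / \<rho>"
        by (auto simp: z_def complex_eq_iff)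
      then have "P = (A + \<rho> * cos (Arg z), B + \<rho> * sin (Arg z))" using P assms(2) by simp
      moreover have "Arg z \<in> {-pi..pi}" using Arg_bounded[of z] by auto
      ultimately show "P \<in> C" unfolding C by blast
    qed
    then show False using assms(2,6) unfolding is_circle_def by blast
  qed
  \<comment> \<open>The largest frequency, attained only by \<open>l1 m\<close>; all other
    frequencies are smaller in absolute value and nonzero.\<close>
  define D where "D = n * m + 1"
  have D: "D \<ge> 2" using m assms(1) by (simp add: D_def)
  have l1m: "l1 m = int D" by (simp add: l1_def D_def mult.commute)
  have l1: "\<bar>l1 k\<bar> < int D" "l1 k \<noteq> 0" if "k < m" for k
    using that assms(1) by (simp_all add: l1_def D_def abs_if mult.commute flip: of_nat_mult)
  have l2: "\<bar>l2 k\<bar> < int D" "l2 k \<noteq> 0" if "k \<le> m" for k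
  proof -
    have "int k * int n \<le> int n * int m"
      unfolding mult.commute[of "int n"] using that by (intro mult_right_mono) auto
    moreover have "0 \<le> int k * int n" "0 < int n * int m" using m assms(1) by simp_all
    ultimately show "\<bar>l2 k\<bar> < int D"
      unfolding l2_def D_def of_nat_add of_nat_mult of_nat_1 by linarith
    show "l2 k \<noteq> 0" using assms(1) by (auto simp: l2_def zmult_eq_1_iff)
  qed
  define h where "h = (\<lambda>l. harmonic D (a l) (b l) l)"
  define U where "U = monom (of_real \<rho>) D + h (int D) + (\<Sum>k<m. h (l1 k)) + (\<Sum>k=0..m. h (l2 k))"
  have poly_h: "poly (h l) (cis \<theta>) = of_real (q l \<theta>) * cis \<theta> ^ D" if "\<bar>l\<bar> \<le> int D" for l \<theta>
    unfolding h_def q_def using that by (rule poly_harmonic_cis)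
  have "(\<Sum>k<m. coeff (h (l1 k)) j) = 0" "(\<Sum>k=0..m. coeff (h (l2 k)) j) = 0"
    if "j = 0 \<or> j = 2 * D \<or> j = D" for j
    using that l1 l2
    by (auto intro!: sum.neutral simp: h_def coeff_harmonic_inner coeff_harmonic_middle less_imp_le)
  then have coeff_U: "coeff U j = coeff (monom (of_real \<rho>) D) j + coeff (h (int D)) j"
    if "j = 0 \<or> j = 2 * D \<or> j = D" for j
    using that unfolding U_def by (simp add: coeff_sum)
  have ab: "Complex (a (int D)) (b (int D)) \<noteq> 0" "Complex (a (int D)) (- b (int D)) \<noteq> 0"
    using assms(7) by (auto simp: D_def complex_eq_iff add.commute)
  interpret support_function U D p "deriv p"
  proof
    show "D \<ge> 2" by (rule D)
    show "coeff U 0 \<noteq> 0" using coeff_U[of 0] D ab by (auto simp: h_def coeff_harmonic_outer)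
    \<comment> \<open>No harmonic contributes to exponent D, so this coefficient is \<rho>.\<close>
    show "coeff U D \<noteq> 0"
      using coeff_U[of D] D assms(2) by (simp add: h_def coeff_harmonic_middle)
    have "coeff U (2 * D) \<noteq> 0" using coeff_U[of "2 * D"] D ab by (auto simp: h_def coeff_harmonic_outer)
    moreover have "degree U \<le> 2 * D"
      unfolding U_def h_def
      by (intro degree_add_le degree_sum_le degree_harmonic_le order_trans[OF degree_monom_le])
        (use l1 l2 in \<open>auto simp: less_imp_le\<close>)
    ultimately show "degree U = 2 * D" by (intro antisym le_degree)
    show "poly U (cis \<theta>) = of_real (p \<theta>) * cis \<theta> ^ D" for \<theta>
    proof -
      have "poly U (cis \<theta>) = of_real (\<rho> + q (l1 m) \<theta> + (\<Sum>k<m. q (l1 k) \<theta>) + (\<Sum>k=0..m. q (l2 k) \<theta>)) * cis \<theta> ^ D"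
        unfolding U_def l1m using l1 l2
        by (simp add: poly_sum poly_monom poly_h less_imp_le distrib_right sum_distrib_right)
      also have "\<rho> + q (l1 m) \<theta> + (\<Sum>k<m. q (l1 k) \<theta>) + (\<Sum>k=0..m. q (l2 k) \<theta>) = p \<theta>"
        by (simp add: p_eq sum.distrib atLeast0AtMost lessThan_Suc_atMost[symmetric])
      finally show ?thesis .
    qed
    show "(p has_real_derivative deriv p \<theta>) (at \<theta>)" for \<theta>
      using dp unfolding deriv_p .
  qed
  have "2 * D + 2 = 2 * n * m + 4" by (simp add: D_def)
  then show ?thesis using support_curve_degrees[OF C_def] by simp
qed

end
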